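(* Let $L_1$ and $L_2$ be smooth Lagrangian submanifolds in $\mathbb{C}^n$ intersecting transversally at a point $p$. Then the union $L_1\cup L_2$ is locally polynomially convex near $p$.
   Context: $\mathbb{C}^n$ with coordinates $z_j=x_j+iy_j$ carries the standard symplectic form $\omega=\sum_j dx_j\wedge dy_j$; a Lagrangian submanifold is a real $n$-dimensional (embedded) submanifold on which $\omega$ vanishes. "Smooth" means $C^\infty$. A closed subset $X$ of $\mathbb{C}^n$ (or a set closed in a neighbourhood of $p$, as embedded submanifolds are) is called locally polynomially convex near a point $p\in X$ if for every sufficiently small $\varepsilon>0$ the intersection $X\cap\overline{\mathbb{B}_n(p,\varepsilon)}$ with the closed Euclidean ball of centre $p$ and radius $\varepsilon$ is polynomially convex. *)

theory Defs
  imports "HOL-Analysis.Analysis"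
begin

text \<open>
  Complex affine \<open>n\<close>-space is the type \<open>complex ^ 'n\<close> with \<open>n = CARD('n)\<close>, regarded as a real
  Euclidean space. In particular \<open>cball\<close> is the closed Euclidean ball, and \<open>subspace\<close>, \<open>dim\<close> and
  derivatives are taken over the reals.
\<close>

subsection \<open>Smooth maps and embedded submanifolds\<close>

text \<open>
  For open \<open>S\<close> in a finite-dimensional space this is \<open>C\<^sup>k\<close> on \<open>S\<close>: evaluating the derivative in all
  directions \<open>v\<close> covers all partial derivatives.
\<close>
primrec Ck_on :: "nat \<Rightarrow> ('a::euclidean_space \<Rightarrow> 'b::euclidean_space) \<Rightarrow> 'a set \<Rightarrow> bool" where
  "Ck_on 0 f S \<longleftrightarrow> continuous_on S f"
| "Ck_on (Suc k) f S \<longleftrightarrow>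
     (\<forall>x\<in>S. f differentiable (at x)) \<and> (\<forall>v. Ck_on k (\<lambda>x. frechet_derivative f (at x) v) S)"

definition smooth_on :: "('a::euclidean_space \<Rightarrow> 'b::euclidean_space) \<Rightarrow> 'a set \<Rightarrow> bool" where
  "smooth_on f S \<longleftrightarrow> (\<forall>k. Ck_on k f S)"

text \<open>
  Slice charts: near each of its points, \<open>M\<close> is straightened to a piece of a \<open>d\<close>-dimensional
  linear subspace by a diffeomorphism \<open>\<phi> : U \<rightarrow> V\<close> (with inverse \<open>\<psi>\<close>) of open subsets of the
  ambient space. \<open>M\<close> need not be closed in the ambient space.
\<close>
definition smooth_submanifold :: "nat \<Rightarrow> 'a::euclidean_space set \<Rightarrow> bool" where
  "smooth_submanifold d M \<longleftrightarrow>
     (\<forall>x\<in>M. \<exists>U V (\<phi> :: 'a \<Rightarrow> 'a) \<psi> E.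
        open U \<and> open V \<and> x \<in> U \<and> homeomorphism U V \<phi> \<psi> \<and>
        smooth_on \<phi> U \<and> smooth_on \<psi> V \<and>
        subspace E \<and> dim E = d \<and> \<phi> ` (M \<inter> U) = E \<inter> V)"

text \<open>Velocities at \<open>x\<close> of smooth curves in \<open>M\<close>.\<close>
definition tangent_space :: "'a::euclidean_space set \<Rightarrow> 'a \<Rightarrow> 'a set" where
  "tangent_space M x =
     {v. \<exists>(\<gamma> :: real \<Rightarrow> 'a) e. e > 0 \<and> smooth_on \<gamma> {-e<..<e} \<and> \<gamma> ` {-e<..<e} \<subseteq> M \<and>
           \<gamma> 0 = x \<and> (\<gamma> has_vector_derivative v) (at 0)}"

definition intersect_transversally_at ::
    "'a::euclidean_space set \<Rightarrow> 'a set \<Rightarrow> 'a \<Rightarrow> bool" where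
  "intersect_transversally_at M N p \<longleftrightarrow>
     p \<in> M \<inter> N \<and> {u + v | u v. u \<in> tangent_space M p \<and> v \<in> tangent_space N p} = UNIV"


subsection \<open>Lagrangian submanifolds\<close>

text \<open>\<open>\<Sum>\<^sub>j dx\<^sub>j \<and> dy\<^sub>j\<close> with \<open>z\<^sub>j = x\<^sub>j + i y\<^sub>j\<close>.\<close>
definition symplectic_form :: "complex ^ 'n \<Rightarrow> complex ^ 'n \<Rightarrow> real" where
  "symplectic_form u v = (\<Sum>j\<in>UNIV. Re (u $ j) * Im (v $ j) - Im (u $ j) * Re (v $ j))"

definition lagrangian_submanifold :: "(complex ^ 'n) set \<Rightarrow> bool" where
  "lagrangian_submanifold L \<longleftrightarrow>
     smooth_submanifold CARD('n) L \<and>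
     (\<forall>x\<in>L. \<forall>u\<in>tangent_space L x. \<forall>v\<in>tangent_space L x. symplectic_form u v = 0)"


subsection \<open>Polynomial convexity\<close>

text \<open>Polynomials in the holomorphic coordinates; \<open>\<alpha>\<close> ranges over multi-indices.\<close>
definition holomorphic_polynomial :: "(complex ^ 'n \<Rightarrow> complex) \<Rightarrow> bool" where
  "holomorphic_polynomial P \<longleftrightarrow>
     (\<exists>(A :: ('n \<Rightarrow> nat) set) (c :: ('n \<Rightarrow> nat) \<Rightarrow> complex). finite A \<and>
        P = (\<lambda>z. \<Sum>\<alpha>\<in>A. c \<alpha> * (\<Prod>j\<in>UNIV. (z $ j) ^ \<alpha> j)))"

text \<open>
  Only meaningful for compact \<open>K\<close>, where the supremum exists. For \<open>K = {}\<close> the value of the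
  supremum is irrelevant: large constant polynomials show that the hull is empty.
\<close>
definition polynomial_hull :: "(complex ^ 'n) set \<Rightarrow> (complex ^ 'n) set" where
  "polynomial_hull K =
     {z. \<forall>P. holomorphic_polynomial P \<longrightarrow> norm (P z) \<le> (SUP w\<in>K. norm (P w))}"

definition polynomially_convex :: "(complex ^ 'n) set \<Rightarrow> bool" where
  "polynomially_convex K \<longleftrightarrow> compact K \<and> polynomial_hull K = K"

text \<open>
  Compactness of the intersections, part of \<open>polynomially_convex\<close>, says that \<open>X\<close> is closed near
  \<open>p\<close>; global closedness is not required.
\<close>
definition locally_polynomially_convex_near :: "(complex ^ 'n) set \<Rightarrow> complex ^ 'n \<Rightarrow> bool" where
  "locally_polynomially_convex_near X p \<longleftrightarrow>
     p \<in> X \<and> (\<exists>r>0. \<forall>\<epsilon>. 0 < \<epsilon> \<and> \<epsilon> < r \<longrightarrow> polynomially_convex (X \<inter> cball p \<epsilon>))"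

end

theory Submission imports Defs begin

text \<open>
  A Lagrangian plane \<open>T\<close> carries a holomorphic quadratic form \<open>Q\<close> with
  \<open>Re (Q z) = norm\<^sup>2 z - 2 dist\<^sup>2 (z, T)\<close>. If \<open>L\<close> is tangent to \<open>T\<close> at \<open>p\<close>, a point \<open>z\<^sub>0 \<notin> L\<close> near \<open>p\<close>
  with nearest point \<open>c\<close> in \<open>L\<close> is separated from \<open>L\<close> by \<open>exp (- Q (z - c))\<close>: secants of \<open>L\<close> are
  almost in \<open>T\<close>, where \<open>Re Q > 0\<close>, while \<open>z\<^sub>0 - c\<close> is almost orthogonal to \<open>T\<close>, where \<open>Re Q < 0\<close>.
  For two transversal planes, \<open>Q\<^sub>2 - Q\<^sub>1\<close> maps \<open>L\<^sub>1\<close> and \<open>L\<^sub>2\<close> near \<open>p\<close> into opposite sectors of the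
  complex plane that meet only in \<open>0\<close>, so Kallin's lemma gives the union. The lemma is proved with
  the logistic functions \<open>1 / (1 + exp (- m \<zeta>))\<close>, which are uniformly bounded on the double sector
  and tend to \<open>1\<close> on one half and to \<open>0\<close> on the other.
\<close>

subsection \<open>Holomorphic polynomials and uniform approximation\<close>

text \<open>The separating functions are not polynomials, and a logistic function of
  \<open>\<zeta>\<close> has poles, so no single power series represents it on the compact sets in
  question. Everything therefore takes place among uniform limits of polynomials, and reciprocals
  are reached by continuation: starting from a constant, one moves through functions without zeros
  in small steps, each of which is a Neumann series. That the bound on the logistic functions is
  uniform in \<open>m\<close> fixes the order of choices in Kallin's lemma: first the bound, then a
  polynomial small on one piece and \<open>1\<close> at \<open>z0\<close>, and \<open>m\<close> only
  at the end, to suppress that polynomial where it is large on the other piece. For one sheet, the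
  same form \<open>Q\<close>, taken at \<open>p\<close>, serves every base point \<open>c\<close>.
  This works because differentiability at \<open>p\<close> is used in its strict form, which
  controls secants between any two nearby points, and because \<open>Re Q\<close> changes sign only
  at 45 degrees to \<open>T\<close>: secants with relative error \<open>1/2\<close> and normals that
  are only roughly orthogonal are still on the correct side.\<close>

lemma holomorphic_polynomial_family:
  fixes \<alpha> :: "'i \<Rightarrow> 'n::finite \<Rightarrow> nat"
  assumes "finite I"
  shows "holomorphic_polynomial (\<lambda>z :: complex ^ 'n. \<Sum>i\<in>I. c i * (\<Prod>j\<in>UNIV. (z $ j) ^ \<alpha> i j))"
  unfolding holomorphic_polynomial_def
proof (intro exI conjI ext)
  show "finite (\<alpha> ` I)" using assms by simp
  fix z :: "complex ^ 'n"
  \<comment> \<open>A holomorphic polynomial has one coefficient per multi-index, so indices with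
    equal exponents are grouped. Arbitrary index sets then allow a disjoint union for sums and a
    product set for products.\<close>
  have "(\<Sum>i\<in>I. c i * (\<Prod>j\<in>UNIV. (z $ j) ^ \<alpha> i j)) =
        (\<Sum>y\<in>\<alpha> ` I. \<Sum>i\<in>{i\<in>I. \<alpha> i = y}. c i * (\<Prod>j\<in>UNIV. (z $ j) ^ \<alpha> i j))"
    by (rule sum.image_gen[OF assms])
  also have "\<dots> = (\<Sum>y\<in>\<alpha> ` I. (\<Sum>i\<in>{i\<in>I. \<alpha> i = y}. c i) * (\<Prod>j\<in>UNIV. (z $ j) ^ y j))"
    by (intro sum.cong refl) (simp add: sum_distrib_right)
  finally show "(\<Sum>i\<in>I. c i * (\<Prod>j\<in>UNIV. (z $ j) ^ \<alpha> i j)) =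
      (\<Sum>y\<in>\<alpha> ` I. (\<lambda>y. \<Sum>i\<in>{i\<in>I. \<alpha> i = y}. c i) y * (\<Prod>j\<in>UNIV. (z $ j) ^ y j))" .
qed

lemma holomorphic_polynomial_const: "holomorphic_polynomial (\<lambda>z :: complex ^ 'n. a)"
  using holomorphic_polynomial_family[where I = "{()}" and c = "\<lambda>_. a" and \<alpha> = "\<lambda>_ _. 0"] by simp

lemma holomorphic_polynomial_coord: "holomorphic_polynomial (\<lambda>z :: complex ^ 'n. z $ k)"
proof -
  have "(\<Prod>j\<in>UNIV. (z $ j) ^ (if j = k then 1 else 0)) = z $ k" for z :: "complex ^ 'n"
    by (simp add: if_distrib prod.delta cong: if_cong)
  then show ?thesis
    using holomorphic_polynomial_family[where I = "{()}" and c = "\<lambda>_. 1"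
        and \<alpha> = "\<lambda>_ j. if j = k then 1 else 0"] by simp
qed

lemma holomorphic_polynomial_add:
  assumes "holomorphic_polynomial P" "holomorphic_polynomial R"
  shows "holomorphic_polynomial (\<lambda>z :: complex ^ 'n. P z + R z)"
proof -
  obtain A c B d where A: "finite A" "P = (\<lambda>z. \<Sum>\<alpha>\<in>A. c \<alpha> * (\<Prod>j\<in>UNIV. (z $ j) ^ \<alpha> j))"
    and B: "finite B" "R = (\<lambda>z. \<Sum>\<alpha>\<in>B. d \<alpha> * (\<Prod>j\<in>UNIV. (z $ j) ^ \<alpha> j))"
    using assms unfolding holomorphic_polynomial_def by blast
  have "(\<lambda>z. P z + R z) = (\<lambda>z. \<Sum>i\<in>A <+> B. case_sum c d i * (\<Prod>j\<in>UNIV. (z $ j) ^ case_sum id id i j))"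
    using A B by (simp add: sum.Plus)
  then show ?thesis
    using holomorphic_polynomial_family[of "A <+> B" "case_sum c d" "case_sum id id"] A B by simp
qed

lemma holomorphic_polynomial_mult:
  assumes "holomorphic_polynomial P" "holomorphic_polynomial R"
  shows "holomorphic_polynomial (\<lambda>z :: complex ^ 'n. P z * R z)"
proof -
  obtain A c B d where A: "finite A" "P = (\<lambda>z. \<Sum>\<alpha>\<in>A. c \<alpha> * (\<Prod>j\<in>UNIV. (z $ j) ^ \<alpha> j))"
    and B: "finite B" "R = (\<lambda>z. \<Sum>\<alpha>\<in>B. d \<alpha> * (\<Prod>j\<in>UNIV. (z $ j) ^ \<alpha> j))"
    using assms unfolding holomorphic_polynomial_def by blast
  have "(\<lambda>z. P z * R z) = (\<lambda>z. \<Sum>i\<in>A \<times> B. (c (fst i) * d (snd i)) *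
           (\<Prod>j\<in>UNIV. (z $ j) ^ (\<lambda>i j. fst i j + snd i j) i j))"
    unfolding A B
    by (simp add: sum_product sum.cartesian_product power_add prod.distrib case_prod_unfold ac_simps)
  then show ?thesis
    using holomorphic_polynomial_family[of "A \<times> B" "\<lambda>i. c (fst i) * d (snd i)" "\<lambda>i j. fst i j + snd i j"]
      A B by simp
qed

lemma holomorphic_polynomial_diff:
  assumes "holomorphic_polynomial P" "holomorphic_polynomial R"
  shows "holomorphic_polynomial (\<lambda>z :: complex ^ 'n. P z - R z)"
  using holomorphic_polynomial_add[OF assms(1)
      holomorphic_polynomial_mult[OF holomorphic_polynomial_const[of "-1"] assms(2)]] by simp

lemma holomorphic_polynomial_power:
  assumes "holomorphic_polynomial P"
  shows "holomorphic_polynomial (\<lambda>z :: complex ^ 'n. P z ^ k)"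
  by (induction k) (auto intro: holomorphic_polynomial_const holomorphic_polynomial_mult assms)

lemma holomorphic_polynomial_sum:
  assumes "\<And>i. i \<in> I \<Longrightarrow> holomorphic_polynomial (P i)"
  shows "holomorphic_polynomial (\<lambda>z :: complex ^ 'n. \<Sum>i\<in>I. P i z)"
  using assms
  by (induction I rule: infinite_finite_induct)
     (auto intro: holomorphic_polynomial_const holomorphic_polynomial_add)

lemmas holomorphic_polynomial_intros =
  holomorphic_polynomial_const holomorphic_polynomial_coord holomorphic_polynomial_add
  holomorphic_polynomial_diff holomorphic_polynomial_mult holomorphic_polynomial_power
  holomorphic_polynomial_sum

lemma holomorphic_polynomial_continuous_on:
  assumes "holomorphic_polynomial P"
  shows "continuous_on S (P :: complex ^ 'n \<Rightarrow> complex)"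
  using assms unfolding holomorphic_polynomial_def by (auto intro!: continuous_intros)

text \<open>On compact \<open>Y\<close> this is the uniform closure of the polynomials. Separation
  arguments take \<open>Y = insert z0 K\<close>, so that the value at the point to be excluded is
  approximated too.\<close>

definition poly_approx :: "(complex ^ 'n) set \<Rightarrow> (complex ^ 'n \<Rightarrow> complex) \<Rightarrow> bool" where
  "poly_approx Y f \<longleftrightarrow>
     (\<forall>e>0. \<exists>P. holomorphic_polynomial P \<and> (\<forall>z\<in>Y. norm (f z - P z) \<le> e))"

lemma poly_approxE:
  assumes "poly_approx Y f" "e > 0"
  obtains P where "holomorphic_polynomial P" "\<And>z. z \<in> Y \<Longrightarrow> norm (f z - P z) \<le> e"
  using assms unfolding poly_approx_def by blast

lemma poly_approx_polynomial: "holomorphic_polynomial P \<Longrightarrow> poly_approx Y P"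
  unfolding poly_approx_def by (metis diff_self norm_zero less_imp_le)

lemma poly_approx_limit:
  assumes "\<And>e. e > 0 \<Longrightarrow> \<exists>g. poly_approx Y g \<and> (\<forall>z\<in>Y. norm (f z - g z) \<le> e)"
  shows "poly_approx Y f"
  unfolding poly_approx_def
proof (intro allI impI)
  fix e :: real assume e: "e > 0"
  obtain g where g: "poly_approx Y g" "\<And>z. z \<in> Y \<Longrightarrow> norm (f z - g z) \<le> e/2"
    using assms[of "e/2"] e by auto
  obtain P where P: "holomorphic_polynomial P" "\<And>z. z \<in> Y \<Longrightarrow> norm (g z - P z) \<le> e/2"
    using poly_approxE[OF g(1), of "e/2"] e by auto
  have "norm (f z - P z) \<le> e" if "z \<in> Y" for z
    using norm_triangle_ineq[of "f z - g z" "g z - P z"] g(2)[OF that] P(2)[OF that] by simp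
  then show "\<exists>P. holomorphic_polynomial P \<and> (\<forall>z\<in>Y. norm (f z - P z) \<le> e)" using P by blast
qed

lemma poly_approx_cong: "(\<And>z. z \<in> Y \<Longrightarrow> f z = g z) \<Longrightarrow> poly_approx Y f \<Longrightarrow> poly_approx Y g"
  unfolding poly_approx_def by metis

lemma poly_approx_bounded:
  fixes Y :: "(complex ^ 'n) set"
  assumes "compact Y" "poly_approx Y f"
  obtains M where "M > 0" "\<And>z. z \<in> Y \<Longrightarrow> norm (f z) \<le> M"
proof -
  obtain P where P: "holomorphic_polynomial P" "\<And>z. z \<in> Y \<Longrightarrow> norm (f z - P z) \<le> 1"
    using poly_approxE[OF assms(2), of 1] by auto
  have "bounded (P ` Y)"
    by (intro compact_imp_bounded compact_continuous_image
        holomorphic_polynomial_continuous_on P assms)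
  then obtain B where B: "B > 0" "\<And>z. z \<in> Y \<Longrightarrow> norm (P z) \<le> B"
    by (auto simp: bounded_pos)
  have "norm (f z) \<le> B + 1" if "z \<in> Y" for z
    using norm_triangle_ineq[of "f z - P z" "P z"] P(2)[OF that] B(2)[OF that] by simp
  then show thesis using that[of "B + 1"] B by simp
qed

lemma poly_approx_add:
  assumes "poly_approx Y f" "poly_approx Y g"
  shows "poly_approx Y (\<lambda>z. f z + g z)"
  unfolding poly_approx_def
proof (intro allI impI)
  fix e :: real assume e: "e > 0"
  obtain P where P: "holomorphic_polynomial P" "\<And>z. z \<in> Y \<Longrightarrow> norm (f z - P z) \<le> e/2"
    using poly_approxE[OF assms(1), of "e/2"] e by auto
  obtain R where R: "holomorphic_polynomial R" "\<And>z. z \<in> Y \<Longrightarrow> norm (g z - R z) \<le> e/2"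
    using poly_approxE[OF assms(2), of "e/2"] e by auto
  have "norm (f z + g z - (P z + R z)) \<le> e" if "z \<in> Y" for z
    using norm_triangle_ineq[of "f z - P z" "g z - R z"] P(2)[OF that] R(2)[OF that]
    by (simp add: algebra_simps)
  then show "\<exists>P. holomorphic_polynomial P \<and> (\<forall>z\<in>Y. norm (f z + g z - P z) \<le> e)"
    using holomorphic_polynomial_add[OF P(1) R(1)] by blast
qed

lemma poly_approx_mult:
  assumes "compact Y" "poly_approx Y f" "poly_approx Y g"
  shows "poly_approx Y (\<lambda>z. f z * g z)"
  unfolding poly_approx_def
proof (intro allI impI)
  fix e :: real assume e: "e > 0"
  obtain M where M: "M > 0" "\<And>z. z \<in> Y \<Longrightarrow> norm (g z) \<le> M"
    using poly_approx_bounded[OF assms(1,3)] by blast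
  obtain P where P: "holomorphic_polynomial P" "\<And>z. z \<in> Y \<Longrightarrow> norm (f z - P z) \<le> e / (2 * M)"
    using poly_approxE[OF assms(2), of "e / (2 * M)"] e M by auto
  obtain N where N: "N > 0" "\<And>z. z \<in> Y \<Longrightarrow> norm (P z) \<le> N"
    using poly_approx_bounded[OF assms(1) poly_approx_polynomial[OF P(1)]] by blast
  obtain R where R: "holomorphic_polynomial R" "\<And>z. z \<in> Y \<Longrightarrow> norm (g z - R z) \<le> e / (2 * N)"
    using poly_approxE[OF assms(3), of "e / (2 * N)"] e N by auto
  have "norm (f z * g z - P z * R z) \<le> e" if z: "z \<in> Y" for z
  proof -
    have "f z * g z - P z * R z = (f z - P z) * g z + P z * (g z - R z)"
      by (simp add: algebra_simps)
    also have "norm \<dots> \<le> norm (f z - P z) * norm (g z) + norm (P z) * norm (g z - R z)"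
      by (metis norm_mult norm_triangle_ineq)
    also have "\<dots> \<le> e / (2 * M) * M + N * (e / (2 * N))"
      using P(2)[OF z] R(2)[OF z] M N z e
      by (intro add_mono mult_mono) auto
    also have "\<dots> = e" using M N by simp
    finally show ?thesis .
  qed
  then show "\<exists>P. holomorphic_polynomial P \<and> (\<forall>z\<in>Y. norm (f z * g z - P z) \<le> e)"
    using holomorphic_polynomial_mult[OF P(1) R(1)] by blast
qed

lemma poly_approx_diff:
  assumes "compact Y" "poly_approx Y f" "poly_approx Y g"
  shows "poly_approx Y (\<lambda>z. f z - g z)"
proof -
  have "poly_approx Y (\<lambda>z. f z + (-1) * g z)"
    by (intro poly_approx_add poly_approx_mult assms poly_approx_polynomial
        holomorphic_polynomial_const)
  then show ?thesis by simp
qed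

lemma poly_approx_const: "poly_approx Y (\<lambda>z. a)"
  by (intro poly_approx_polynomial holomorphic_polynomial_const)

lemma poly_approx_sum:
  assumes "\<And>i. i \<in> I \<Longrightarrow> poly_approx Y (f i)"
  shows "poly_approx Y (\<lambda>z. \<Sum>i\<in>I. f i z)"
  using assms by (induction I rule: infinite_finite_induct) (auto intro: poly_approx_const poly_approx_add)

lemma poly_approx_power:
  assumes "compact Y" "poly_approx Y f"
  shows "poly_approx Y (\<lambda>z. f z ^ k)"
  by (induction k) (auto intro: poly_approx_const poly_approx_mult assms)

lemma poly_approx_power_series:
  fixes c :: "nat \<Rightarrow> complex"
  assumes "compact Y" "poly_approx Y f" and r: "\<And>z. z \<in> Y \<Longrightarrow> norm (f z) \<le> r"
    and c: "summable (\<lambda>k. norm (c k) * r ^ k)"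
  shows "poly_approx Y (\<lambda>z. \<Sum>k. c k * f z ^ k)"
proof (rule poly_approx_limit)
  fix e :: real assume e: "e > 0"
  have "uniform_limit Y (\<lambda>n z. \<Sum>k<n. c k * f z ^ k) (\<lambda>z. \<Sum>k. c k * f z ^ k) sequentially"
  proof (rule Weierstrass_m_test[OF _ c])
    fix n z assume "z \<in> Y"
    then show "norm (c n * f z ^ n) \<le> norm (c n) * r ^ n"
      using r by (simp add: norm_mult norm_power mult_left_mono power_mono)
  qed
  then have "\<forall>\<^sub>F n in sequentially. \<forall>z\<in>Y. dist (\<Sum>k<n. c k * f z ^ k) (\<Sum>k. c k * f z ^ k) < e"
    using e by (rule uniform_limitD)
  then obtain n where n: "\<forall>z\<in>Y. dist (\<Sum>k<n. c k * f z ^ k) (\<Sum>k. c k * f z ^ k) < e"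
    by (auto simp: eventually_sequentially)
  moreover have "poly_approx Y (\<lambda>z. \<Sum>k<n. c k * f z ^ k)"
    by (intro poly_approx_sum poly_approx_mult poly_approx_const poly_approx_power assms)
  ultimately show "\<exists>g. poly_approx Y g \<and> (\<forall>z\<in>Y. norm ((\<Sum>k. c k * f z ^ k) - g z) \<le> e)"
    by (intro exI[of _ "\<lambda>z. \<Sum>k<n. c k * f z ^ k"]) (auto simp: dist_norm norm_minus_commute less_imp_le)
qed

lemma poly_approx_exp:
  assumes "compact Y" "poly_approx Y f"
  shows "poly_approx Y (\<lambda>z. exp (f z))"
proof -
  obtain M where M: "M > 0" "\<And>z. z \<in> Y \<Longrightarrow> norm (f z) \<le> M"
    using poly_approx_bounded[OF assms] by blast
  have "poly_approx Y (\<lambda>z. \<Sum>k. (1 / fact k) * f z ^ k)"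
  proof (rule poly_approx_power_series[OF assms M(2)])
    have "summable (\<lambda>k. M ^ k /\<^sub>R fact k)" by (rule summable_exp_generic)
    then show "summable (\<lambda>k. norm (1 / fact k :: complex) * M ^ k)"
      by (simp add: norm_divide field_simps)
  qed
  then show ?thesis
    by (rule poly_approx_cong[rotated]) (simp add: exp_def scaleR_conv_of_real field_simps)
qed

text \<open>Neumann series: with \<open>x = (f - g) / f\<close> one has
  \<open>1 / g = (1 / f) * (\<Sum>k. x ^ k)\<close>, and \<open>close\<close> gives
  \<open>norm x \<le> 1/2\<close>.\<close>

lemma poly_approx_inverse_step:
  assumes Y: "compact Y" and f: "poly_approx Y f" "poly_approx Y (\<lambda>z. 1 / f z)" and g: "poly_approx Y g"
    and nz: "\<And>z. z \<in> Y \<Longrightarrow> f z \<noteq> 0" and close: "\<And>z. z \<in> Y \<Longrightarrow> norm (g z - f z) \<le> norm (f z) / 2"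
  shows "poly_approx Y (\<lambda>z. 1 / g z)"
proof -
  let ?x = "\<lambda>z. (f z - g z) * (1 / f z)"
  have x: "norm (?x z) \<le> 1/2" if "z \<in> Y" for z
    using close[OF that] nz[OF that] by (simp add: norm_mult norm_divide norm_minus_commute field_simps)
  have "poly_approx Y (\<lambda>z. (1 / f z) * (\<Sum>k. 1 * ?x z ^ k))"
  proof (intro poly_approx_mult[OF Y f(2)] poly_approx_power_series[OF Y _ x])
    show "poly_approx Y ?x" by (intro poly_approx_mult poly_approx_diff Y f g)
    show "summable (\<lambda>k. norm (1::complex) * (1/2::real) ^ k)" by (simp add: summable_geometric)
  qed
  then show ?thesis
  proof (rule poly_approx_cong[rotated])
    fix z assume z: "z \<in> Y"
    have "(\<Sum>k. ?x z ^ k) = 1 / (1 - ?x z)"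
      using x[OF z] by (intro suminf_geometric) simp
    moreover have "1 - ?x z = g z / f z" using nz[OF z] by (simp add: field_simps)
    ultimately show "(1 / f z) * (\<Sum>k. 1 * ?x z ^ k) = 1 / g z" using nz[OF z] by simp
  qed
qed

text \<open>Continuation in \<open>t\<close>: by compactness \<open>norm (D t z)\<close> has a
  positive lower bound \<open>m\<close>, and by uniform continuity finitely many steps change
  \<open>D\<close> by less than \<open>m / 2\<close> each, so Neumann series carry invertibility
  from \<open>t = 0\<close> to \<open>t = 1\<close>. The polynomial hull of \<open>Y\<close> never
  has to be known.\<close>

lemma poly_approx_inverse_homotopy:
  fixes D :: "real \<Rightarrow> complex ^ 'n \<Rightarrow> complex"
  assumes Y: "compact Y" and cont: "continuous_on ({0..1} \<times> Y) (\<lambda>(t, z). D t z)"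
    and nz: "\<And>t z. t \<in> {0..1} \<Longrightarrow> z \<in> Y \<Longrightarrow> D t z \<noteq> 0"
    and D: "\<And>t. t \<in> {0..1} \<Longrightarrow> poly_approx Y (D t)" and D0: "poly_approx Y (\<lambda>z. 1 / D 0 z)"
  shows "poly_approx Y (\<lambda>z. 1 / D 1 z)"
proof -
  let ?E = "{0..1::real} \<times> Y"
  have E: "compact ?E" by (intro compact_Times Y) auto
  obtain m where m: "m > 0" "\<And>t z. t \<in> {0..1} \<Longrightarrow> z \<in> Y \<Longrightarrow> norm (D t z) \<ge> m"
  proof (cases "Y = {}")
    case True then show thesis using that[of 1] by auto
  next
    case False
    then have "\<exists>x\<in>?E. \<forall>y\<in>?E. norm (case x of (t, z) \<Rightarrow> D t z) \<le> norm (case y of (t, z) \<Rightarrow> D t z)"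
      by (intro continuous_attains_inf[OF E _ continuous_on_norm[OF cont]]) auto
    then obtain t0 z0 where x: "(t0, z0) \<in> ?E" "\<forall>y\<in>?E. norm (D t0 z0) \<le> norm (case y of (t, z) \<Rightarrow> D t z)"
      by auto
    show thesis
    proof (rule that[of "norm (D t0 z0)"])
      show "norm (D t0 z0) > 0" using x nz by auto
      show "norm (D t0 z0) \<le> norm (D t z)" if "t \<in> {0..1}" "z \<in> Y" for t z
        using bspec[OF x(2), of "(t, z)"] that by simp
    qed
  qed
  have "uniformly_continuous_on ?E (\<lambda>(t, z). D t z)"
    by (rule compact_uniformly_continuous[OF cont E])
  then obtain d where d: "d > 0"
    "\<And>x y. x \<in> ?E \<Longrightarrow> y \<in> ?E \<Longrightarrow> dist y x < d \<Longrightarrow>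
      dist (case y of (t, z) \<Rightarrow> D t z) (case x of (t, z) \<Rightarrow> D t z) < m / 2"
    unfolding uniformly_continuous_on_def using m(1) half_gt_zero by metis
  obtain N :: nat where N: "N > 0" "1 / real N < d"
    using reals_Archimedean[OF d(1)] by (metis inverse_eq_divide of_nat_0_less_iff zero_less_Suc)
  have "poly_approx Y (\<lambda>z. 1 / D (real k / real N) z)" if "k \<le> N" for k
    using that
  proof (induction k)
    case 0 then show ?case using D0 by simp
  next
    case (Suc k)
    let ?t = "real k / real N" and ?s = "real (Suc k) / real N"
    have ts: "?t \<in> {0..1}" "?s \<in> {0..1}" using Suc.prems N by (auto simp: field_simps)
    show ?case
    proof (rule poly_approx_inverse_step[OF Y D[OF ts(1)] _ D[OF ts(2)] nz[OF ts(1)]])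
      show "poly_approx Y (\<lambda>z. 1 / D ?t z)" using Suc by simp
      fix z assume z: "z \<in> Y"
      have "dist ?s ?t = 1 / real N" by (simp add: dist_real_def flip: diff_divide_distrib)
      then have "dist (?s, z) (?t, z) < d" using N by (simp add: dist_Pair_Pair)
      then have "norm (D ?s z - D ?t z) < m / 2"
        using d(2)[of "(?t, z)" "(?s, z)"] ts z by (simp add: dist_norm)
      then show "norm (D ?s z - D ?t z) \<le> norm (D ?t z) / 2" using m(2)[OF ts(1) z] by linarith
    qed auto
  qed
  from this[of N] show ?thesis using N by simp
qed

subsection \<open>Separation criteria for polynomial convexity\<close>

lemma polynomially_convexI:
  fixes K :: "(complex ^ 'n) set"
  assumes K: "compact K"
    and sep: "\<And>z0. z0 \<notin> K \<Longrightarrow>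
      \<exists>f a. poly_approx (insert z0 K) f \<and> (\<forall>z\<in>K. norm (f z) \<le> a) \<and> a < norm (f z0)"
  shows "polynomially_convex K"
  unfolding polynomially_convex_def
proof (intro conjI K equalityI subsetI)
  fix z assume z: "z \<in> K"
  have "norm (P z) \<le> (SUP w\<in>K. norm (P w))" if P: "holomorphic_polynomial P" for P
    by (intro cSUP_upper z bounded_imp_bdd_above compact_imp_bounded compact_continuous_image K
        continuous_intros holomorphic_polynomial_continuous_on P)
  then show "z \<in> polynomial_hull K" by (simp add: polynomial_hull_def)
next
  fix z0 assume z0: "z0 \<in> polynomial_hull K"
  show "z0 \<in> K"
  proof (rule ccontr)
    assume nK: "z0 \<notin> K"
    show False
    proof (cases "K = {}")
      case True
      \<comment> \<open>For empty \<open>K\<close> the supremum in the hull is the unspecified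
        number \<open>Sup {}\<close>; a constant polynomial of larger modulus excludes every
        point.\<close>
      let ?c = "complex_of_real (\<bar>Sup {} :: real\<bar> + 1)"
      have "norm ?c \<le> Sup {}"
        using z0 holomorphic_polynomial_const[of ?c] True
        unfolding polynomial_hull_def by fastforce
      then show False by simp
    next
      case False
      obtain f a where f: "poly_approx (insert z0 K) f" "\<And>z. z \<in> K \<Longrightarrow> norm (f z) \<le> a" "a < norm (f z0)"
        using sep[OF nK] by blast
      \<comment> \<open>A third of the gap: the approximation error is spent once on
        \<open>K\<close> and once at \<open>z0\<close>, and a third remains.\<close>
      define e where "e = (norm (f z0) - a) / 3"
      have e: "e > 0" using f by (simp add: e_def)
      obtain P where P: "holomorphic_polynomial P" "\<And>z. z \<in> insert z0 K \<Longrightarrow> norm (f z - P z) \<le> e"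
        using poly_approxE[OF f(1) e] by blast
      have "(SUP w\<in>K. norm (P w)) \<le> a + e"
      proof (rule cSUP_least[OF False])
        fix w assume w: "w \<in> K"
        show "norm (P w) \<le> a + e"
          using norm_triangle_ineq[of "f w" "P w - f w"] f(2)[OF w] P(2)[of w] w
          by (simp add: norm_minus_commute)
      qed
      moreover have "norm (P z0) \<ge> norm (f z0) - e"
        using norm_triangle_ineq[of "P z0" "f z0 - P z0"] P(2)[of z0] by simp
      moreover have "norm (P z0) \<le> (SUP w\<in>K. norm (P w))"
        using z0 P(1) by (simp add: polynomial_hull_def)
      ultimately show False using f(3) by (simp add: e_def field_simps)
    qed
  qed
qed

text \<open>A separating polynomial is normalised to the value \<open>1\<close> at
  \<open>z0\<close>; its bound on \<open>K\<close> is then below \<open>1\<close>, and a high power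
  makes it arbitrarily small.\<close>

lemma polynomially_convex_separate:
  fixes K :: "(complex ^ 'n) set"
  assumes K: "polynomially_convex K" and z0: "z0 \<notin> K" and e: "e > 0"
  obtains P where "holomorphic_polynomial P" "P z0 = 1" "\<And>z. z \<in> K \<Longrightarrow> norm (P z) \<le> e"
proof (cases "K = {}")
  case True
  then show thesis using that[of "\<lambda>_. 1"] holomorphic_polynomial_const by auto
next
  case False
  have cK: "compact K" using K by (simp add: polynomially_convex_def)
  have "z0 \<notin> polynomial_hull K" using K z0 by (simp add: polynomially_convex_def)
  then obtain P where P: "holomorphic_polynomial P" "norm (P z0) > (SUP w\<in>K. norm (P w))"
    by (auto simp: polynomial_hull_def not_le)
  define S where "S = (SUP w\<in>K. norm (P w))"
  have S: "norm (P z) \<le> S" if "z \<in> K" for z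
    unfolding S_def
    by (intro cSUP_upper that bounded_imp_bdd_above compact_imp_bounded compact_continuous_image cK
        continuous_intros holomorphic_polynomial_continuous_on P)
  then have S0: "0 \<le> S" using False norm_ge_zero order_trans by blast
  have pos: "norm (P z0) > 0" using P(2) S0 unfolding S_def by linarith
  have "S / norm (P z0) < 1" using P(2) pos by (simp add: S_def)
  then obtain N where N: "(S / norm (P z0)) ^ N < e" using real_arch_pow_inv[OF e] by blast
  show thesis
  proof
    show "holomorphic_polynomial (\<lambda>z. ((1 / P z0) * P z) ^ N)"
      by (intro holomorphic_polynomial_intros P)
    show "((1 / P z0) * P z0) ^ N = 1" using pos by (simp del: norm_power)
    fix z assume "z \<in> K"
    then have "norm (((1 / P z0) * P z) ^ N) \<le> (S / norm (P z0)) ^ N"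
      using S[of z] pos by (simp add: norm_power norm_mult norm_divide power_mono divide_right_mono)
    then show "norm (((1 / P z0) * P z) ^ N) \<le> e" using N by linarith
  qed
qed

subsection \<open>Kallin's lemma\<close>

text \<open>\<open>1 + exp\<close> vanishes only at odd multiples of \<open>\<i> * pi\<close>, and
  the double sector meets the imaginary axis only at \<open>0\<close>, where the value is
  \<open>2\<close>. Near the axis compactness gives the bound, further out the size of
  \<open>exp\<close>.\<close>

lemma one_plus_exp_bounded_below:
  fixes C :: real
  obtains b where "b > 0" "\<And>s. \<bar>Im s\<bar> \<le> C * \<bar>Re s\<bar> \<Longrightarrow> b \<le> norm (1 + exp s)"
proof -
  define S where "S = {s. \<bar>Im s\<bar> \<le> C * \<bar>Re s\<bar> \<and> \<bar>Re s\<bar> \<le> 1}"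
  have "closed S" unfolding S_def by (intro closed_Collect_conj closed_Collect_le continuous_intros)
  moreover have "bounded S"
  proof (rule boundedI)
    fix s assume s: "s \<in> S"
    then have "C * \<bar>Re s\<bar> \<le> \<bar>C\<bar> * 1" unfolding S_def by (intro mult_mono) auto
    then show "norm s \<le> 1 + \<bar>C\<bar>" using cmod_le[of s] s by (simp add: S_def)
  qed
  ultimately have S: "compact S" by (simp add: compact_eq_bounded_closed)
  have nz: "1 + exp s \<noteq> 0" if "s \<in> S" for s
  proof
    assume 0: "1 + exp s = 0"
    then have "norm (exp s) = 1" by (metis add_eq_0_iff norm_minus_cancel norm_one)
    then have "Re s = 0" by (simp add: norm_exp_eq_Re)
    moreover have "Im s = 0" using that \<open>Re s = 0\<close> by (simp add: S_def)
    ultimately have "s = 0" by (simp add: complex_eq_iff)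
    with 0 show False by simp
  qed
  have "0 \<in> S" by (simp add: S_def)
  then have "\<exists>x\<in>S. \<forall>y\<in>S. norm (1 + exp x) \<le> norm (1 + exp y)"
    by (intro continuous_attains_inf S continuous_intros) auto
  then obtain x where x: "x \<in> S" "\<And>y. y \<in> S \<Longrightarrow> norm (1 + exp x) \<le> norm (1 + exp y)" by blast
  show thesis
  \<comment> \<open>The second entry serves both ends: for \<open>Re s < -1\<close> it is the bound
    itself, and for \<open>Re s > 1\<close> the norm exceeds \<open>1\<close>.\<close>
  proof (rule that[of "min (norm (1 + exp x)) (1 - exp (-1))"])
    show "min (norm (1 + exp x)) (1 - exp (-1)) > 0" using nz[OF x(1)] by simp
    fix s assume s: "\<bar>Im s\<bar> \<le> C * \<bar>Re s\<bar>"
    consider "s \<in> S" | "Re s > 1" | "Re s < -1" using s by (force simp: S_def)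
    then show "min (norm (1 + exp x)) (1 - exp (-1)) \<le> norm (1 + exp s)"
    proof cases
      case 1 then show ?thesis using x(2) by fastforce
    next
      case 2
      have "exp (Re s) \<ge> 1 + Re s" by (rule exp_ge_add_one_self)
      moreover have "norm (1 + exp s) \<ge> exp (Re s) - 1"
        using norm_triangle_ineq[of "1 + exp s" "-1"] by (simp add: norm_exp_eq_Re)
      moreover have "exp (-1 :: real) > 0" by simp
      ultimately show ?thesis using 2 by linarith
    next
      case 3
      have "exp (Re s) \<le> exp (-1)" using 3 by simp
      moreover have "norm (1 + exp s) \<ge> 1 - exp (Re s)"
        using norm_triangle_ineq[of "1 + exp s" "- exp s"] by (simp add: norm_exp_eq_Re)
      ultimately show ?thesis by linarith
    qed
  qed
qed

text \<open>The true decay is exponential; this rate is enough, as \<open>m\<close> is chosen last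
  and can be as large as needed.\<close>

lemma norm_inverse_one_plus_exp_le:
  assumes "Re s \<ge> x" "x > 0"
  shows "norm (1 / (1 + exp s)) \<le> 1 / x"
proof -
  have "exp (Re s) \<ge> 1 + Re s" by (rule exp_ge_add_one_self)
  moreover have "norm (1 + exp s) \<ge> exp (Re s) - 1"
    using norm_triangle_ineq[of "1 + exp s" "-1"] by (simp add: norm_exp_eq_Re)
  ultimately have "norm (1 + exp s) \<ge> x" using assms by linarith
  then show ?thesis using assms by (simp add: norm_divide frac_le)
qed

text \<open>The path \<open>1 + exp (t * m * \<zeta>)\<close> starts at the constant
  \<open>2\<close>. A double sector is invariant under real factors of either sign, so the lower
  bound for \<open>1 + exp\<close> keeps the path away from \<open>0\<close>.\<close>

lemma poly_approx_logistic:
  fixes Y :: "(complex ^ 'n) set" and m :: real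
  assumes Y: "compact Y" and \<zeta>: "holomorphic_polynomial \<zeta>"
    and cone: "\<And>z. z \<in> Y \<Longrightarrow> \<bar>Im (\<zeta> z)\<bar> \<le> C * \<bar>Re (\<zeta> z)\<bar>"
  shows "poly_approx Y (\<lambda>z. 1 / (1 + exp (of_real m * \<zeta> z)))"
proof -
  let ?D = "\<lambda>t z. 1 + exp (of_real (t * m) * \<zeta> z)"
  obtain b where b: "b > 0" "\<And>s. \<bar>Im s\<bar> \<le> C * \<bar>Re s\<bar> \<Longrightarrow> b \<le> norm (1 + exp s)"
    using one_plus_exp_bounded_below[of C] by blast
  have "poly_approx Y (\<lambda>z. 1 / ?D 1 z)"
  proof (rule poly_approx_inverse_homotopy[OF Y])
    have "continuous_on ({0..1} \<times> Y) (\<lambda>x. \<zeta> (snd x))"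
      by (rule continuous_on_compose2[OF holomorphic_polynomial_continuous_on[OF \<zeta>, of UNIV]])
        (auto intro: continuous_intros)
    then show "continuous_on ({0..1} \<times> Y) (\<lambda>(t, z). ?D t z)"
      unfolding case_prod_unfold by (intro continuous_intros)
    fix t :: real and z assume z: "z \<in> Y"
    have "\<bar>t * m\<bar> * \<bar>Im (\<zeta> z)\<bar> \<le> \<bar>t * m\<bar> * (C * \<bar>Re (\<zeta> z)\<bar>)"
      by (intro mult_left_mono cone z) auto
    then have "b \<le> norm (?D t z)" by (intro b) (simp add: abs_mult ac_simps)
    then show "?D t z \<noteq> 0" using b(1) by (metis norm_zero not_le)
  next
    fix t :: real
    show "poly_approx Y (?D t)"
      by (intro poly_approx_add poly_approx_const poly_approx_exp poly_approx_polynomial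
          holomorphic_polynomial_intros Y \<zeta>)
  next
    show "poly_approx Y (\<lambda>z. 1 / ?D 0 z)" by (simp add: poly_approx_const)
  qed
  then show ?thesis by simp
qed

text \<open>The separating function is \<open>g * P\<close>: \<open>P\<close> is \<open>1\<close> at
  \<open>z0\<close> and small on \<open>K2\<close>, and the logistic factor \<open>g\<close> tends
  to \<open>0\<close> on the side of \<open>K1\<close>. \<open>P\<close> may be large on
  \<open>K1\<close>, but not near \<open>p\<close>, which also lies in \<open>K2\<close>; so it is
  large only where \<open>Re \<zeta>\<close> is bounded away from \<open>0\<close>.\<close>

lemma kallin_half:
  fixes K1 K2 :: "(complex ^ 'n) set"
  assumes K1: "compact K1" and K2: "polynomially_convex K2" and p: "p \<in> K2"
    and \<zeta>: "holomorphic_polynomial \<zeta>"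
    and cone1: "\<And>z. z \<in> K1 \<Longrightarrow> \<bar>Im (\<zeta> z)\<bar> \<le> C * - Re (\<zeta> z)"
    and cone2: "\<And>z. z \<in> K2 \<Longrightarrow> \<bar>Im (\<zeta> z)\<bar> \<le> C * Re (\<zeta> z)"
    and C: "C > 0"
    and zero: "\<And>z. z \<in> K1 \<Longrightarrow> \<zeta> z = 0 \<Longrightarrow> z = p"
    and z0: "z0 \<notin> K2" "Re (\<zeta> z0) > 0"
  shows "\<exists>f a. poly_approx (insert z0 (K1 \<union> K2)) f \<and> (\<forall>z\<in>K1 \<union> K2. norm (f z) \<le> a) \<and> a < norm (f z0)"
proof -
  let ?Y = "insert z0 (K1 \<union> K2)"
  have cK2: "compact K2" using K2 by (simp add: polynomially_convex_def)
  have Y: "compact ?Y" using K1 cK2 by (intro compact_insert compact_Un)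
  \<comment> \<open>The sector is widened to contain \<open>\<zeta> z0\<close>, since
    \<open>g\<close> must be approximated at \<open>z0\<close> as well.\<close>
  define C' where "C' = max C (\<bar>Im (\<zeta> z0)\<bar> / Re (\<zeta> z0))"
  have neg1: "Re (\<zeta> z) \<le> 0" if "z \<in> K1" for z
    using cone1[OF that] C by (metis abs_ge_zero neg_0_le_iff_le order_trans zero_le_mult_iff not_le)
  have pos2: "Re (\<zeta> z) \<ge> 0" if "z \<in> K2" for z
    using cone2[OF that] C by (metis abs_ge_zero order_trans zero_le_mult_iff not_le)
  have cone: "\<bar>Im (\<zeta> z)\<bar> \<le> C' * \<bar>Re (\<zeta> z)\<bar>" if "z \<in> ?Y" for z
  proof -
    have *: "\<bar>Im (\<zeta> z)\<bar> \<le> C * \<bar>Re (\<zeta> z)\<bar>" if "z \<in> K1 \<union> K2"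
      using that cone1[of z] cone2[of z] neg1[of z] pos2[of z] by fastforce
    have "C * \<bar>Re (\<zeta> z)\<bar> \<le> C' * \<bar>Re (\<zeta> z)\<bar>"
      by (rule mult_right_mono) (auto simp: C'_def)
    moreover have "\<bar>Im (\<zeta> z0)\<bar> \<le> C' * \<bar>Re (\<zeta> z0)\<bar>"
    proof -
      have "\<bar>Im (\<zeta> z0)\<bar> = (\<bar>Im (\<zeta> z0)\<bar> / Re (\<zeta> z0)) * \<bar>Re (\<zeta> z0)\<bar>" using z0 by simp
      also have "\<dots> \<le> C' * \<bar>Re (\<zeta> z0)\<bar>" by (rule mult_right_mono) (auto simp: C'_def)
      finally show ?thesis .
    qed
    ultimately show ?thesis using * that by fastforce
  qed
  obtain b where b: "b > 0" "\<And>s. \<bar>Im s\<bar> \<le> C' * \<bar>Re s\<bar> \<Longrightarrow> b \<le> norm (1 + exp s)"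
    using one_plus_exp_bounded_below[of C'] by blast
  \<comment> \<open>The bound \<open>b / 8\<close> on \<open>K2\<close> stays strictly below the
    threshold \<open>b / 4\<close> that defines \<open>K'\<close>; this keeps \<open>p\<close> out
    of \<open>K'\<close>.\<close>
  obtain P where P: "holomorphic_polynomial P" "P z0 = 1" "\<And>z. z \<in> K2 \<Longrightarrow> norm (P z) \<le> b / 8"
    using polynomially_convex_separate[OF K2 z0(1), of "b / 8"] b by auto
  obtain M where M: "M > 0" "\<And>z. z \<in> ?Y \<Longrightarrow> norm (P z) \<le> M"
    using poly_approx_bounded[OF Y poly_approx_polynomial[OF P(1)]] by blast
  define K' where "K' = K1 \<inter> {z. b / 4 \<le> norm (P z)}"
  have "closed {z. b / 4 \<le> norm (P z)}"
    by (intro closed_Collect_le continuous_intros holomorphic_polynomial_continuous_on P)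
  then have K': "compact K'" unfolding K'_def using K1 by (intro compact_Int_closed)
  have neg: "Re (\<zeta> z) < 0" if "z \<in> K'" for z
  proof (rule ccontr)
    assume "\<not> Re (\<zeta> z) < 0"
    with that have z: "z \<in> K1" "Re (\<zeta> z) = 0" using neg1[of z] by (auto simp: K'_def)
    then have "\<zeta> z = 0" using cone1[of z] by (simp add: complex_eq_iff)
    then have "z = p" using zero z by blast
    then show False using that P(3)[OF p] b by (simp add: K'_def)
  qed
  obtain \<mu> where \<mu>: "\<mu> > 0" "\<And>z. z \<in> K' \<Longrightarrow> Re (\<zeta> z) \<le> - \<mu>"
  proof (cases "K' = {}")
    case True then show thesis using that[of 1] by auto
  next
    case False
    then have "\<exists>x\<in>K'. \<forall>y\<in>K'. Re (\<zeta> y) \<le> Re (\<zeta> x)"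
      by (intro continuous_attains_sup K' continuous_intros holomorphic_polynomial_continuous_on \<zeta>)
    then obtain x where "x \<in> K'" "\<And>y. y \<in> K' \<Longrightarrow> Re (\<zeta> y) \<le> Re (\<zeta> x)" by blast
    then show thesis using that[of "- Re (\<zeta> x)"] neg by auto
  qed
  \<comment> \<open>On \<open>K'\<close> the decay \<open>1 / (m * \<mu>)\<close> of
    \<open>g\<close> times the bound \<open>M\<close> for \<open>P\<close> becomes
    \<open>1/4\<close>; off \<open>K'\<close> the product \<open>(1 / b) * (b / 4)\<close> gives the
    same value.\<close>
  define m where "m = 4 * M / \<mu>"
  have m: "m > 0" using M \<mu> by (simp add: m_def)
  define g where "g = (\<lambda>z. 1 / (1 + exp (of_real (- m) * \<zeta> z)))"
  have gb: "norm (g z) \<le> 1 / b" if "z \<in> ?Y" for z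
  proof -
    have "m * \<bar>Im (\<zeta> z)\<bar> \<le> m * (C' * \<bar>Re (\<zeta> z)\<bar>)"
      using m cone[OF that] by (intro mult_left_mono) auto
    then have "b \<le> norm (1 + exp (of_real (- m) * \<zeta> z))"
      using m by (intro b) (simp add: abs_mult ac_simps)
    then show ?thesis unfolding g_def using b(1) by (simp add: norm_divide frac_le)
  qed
  show ?thesis
  proof (intro exI conjI ballI)
    show "poly_approx ?Y (\<lambda>z. g z * P z)"
      unfolding g_def
      by (intro poly_approx_mult Y poly_approx_logistic[where C = C'] poly_approx_polynomial P \<zeta> cone)
    \<comment> \<open>As \<open>Re (\<zeta> z0) > 0\<close>, the norm of \<open>g z0\<close> is at
      least \<open>1/2\<close> for every \<open>m > 0\<close>, which beats
      \<open>1/4\<close>.\<close>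
    have "norm (1 + exp (of_real (- m) * \<zeta> z0)) \<le> 1 + exp (- m * Re (\<zeta> z0))"
      by (rule order_trans[OF norm_triangle_ineq]) (simp add: norm_exp_eq_Re)
    also have "\<dots> \<le> 2" using m z0 by simp
    finally have le2: "norm (1 + exp (of_real (- m) * \<zeta> z0)) \<le> 2" .
    have "b \<le> norm (1 + exp (of_real (- m) * \<zeta> z0))"
    proof -
      have "m * \<bar>Im (\<zeta> z0)\<bar> \<le> m * (C' * \<bar>Re (\<zeta> z0)\<bar>)"
        using m cone[of z0] by (intro mult_left_mono) auto
      then show ?thesis using m by (intro b) (simp add: abs_mult ac_simps)
    qed
    then have "1 / 2 \<le> 1 / norm (1 + exp (of_real (- m) * \<zeta> z0))"
      using le2 b(1) by (intro frac_le) linarith+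
    then show "1/4 < norm (g z0 * P z0)"
      unfolding g_def P(2) by (simp add: norm_divide)
    fix z assume z: "z \<in> K1 \<union> K2"
    show "norm (g z * P z) \<le> 1/4"
    proof (cases "z \<in> K'")
      case False
      then have "norm (P z) \<le> b / 4"
        using z P(3)[of z] b(1) by (auto simp: K'_def)
      then have "norm (g z) * norm (P z) \<le> (1 / b) * (b / 4)"
        using gb[of z] z b by (intro mult_mono) auto
      then show ?thesis using b by (simp add: norm_mult)
    next
      case True
      have "norm (g z) \<le> 1 / (m * \<mu>)"
        unfolding g_def using m \<mu>(1) mult_left_mono[OF \<mu>(2)[OF True], of m]
        by (intro norm_inverse_one_plus_exp_le) auto
      then have "norm (g z) * norm (P z) \<le> 1 / (m * \<mu>) * M"
        using M z m \<mu> by (intro mult_mono) auto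
      also have "\<dots> = 1/4" using M \<mu> by (simp add: m_def)
      finally show ?thesis by (simp add: norm_mult)
    qed
  qed
qed

text \<open>The product \<open>g 1 * g (-1)\<close> of opposite logistic functions is a bump: it is
  \<open>1/4\<close> where \<open>\<zeta>\<close> vanishes and tends to \<open>0\<close> on the rest
  of the double sector. It cannot tell \<open>z0\<close> from \<open>p\<close>, so it is multiplied
  by an affine coordinate function \<open>P\<close> with \<open>P p = 0\<close> and
  \<open>P z0 = 1\<close>.\<close>

lemma kallin_zero:
  fixes K :: "(complex ^ 'n) set"
  assumes K: "compact K" and \<zeta>: "holomorphic_polynomial \<zeta>"
    and cone: "\<And>z. z \<in> K \<Longrightarrow> \<bar>Im (\<zeta> z)\<bar> \<le> C * \<bar>Re (\<zeta> z)\<bar>"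
    and zero: "\<And>z. z \<in> K \<Longrightarrow> \<zeta> z = 0 \<Longrightarrow> z = p"
    and z0: "z0 \<noteq> p" "\<zeta> z0 = 0"
  shows "\<exists>f a. poly_approx (insert z0 K) f \<and> (\<forall>z\<in>K. norm (f z) \<le> a) \<and> a < norm (f z0)"
proof -
  let ?Y = "insert z0 K"
  have Y: "compact ?Y" using K by (rule compact_insert)
  have coneY: "\<bar>Im (\<zeta> z)\<bar> \<le> C * \<bar>Re (\<zeta> z)\<bar>" if "z \<in> ?Y" for z
    using that cone z0 by auto
  obtain b where b: "b > 0" "\<And>s. \<bar>Im s\<bar> \<le> C * \<bar>Re s\<bar> \<Longrightarrow> b \<le> norm (1 + exp s)"
    using one_plus_exp_bounded_below[of C] by blast
  obtain k where k: "z0 $ k \<noteq> p $ k" using z0(1) by (auto simp: vec_eq_iff)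
  define P where "P = (\<lambda>z :: complex ^ 'n. (1 / (z0 $ k - p $ k)) * (z $ k - p $ k))"
  have P: "holomorphic_polynomial P"
    unfolding P_def by (intro holomorphic_polynomial_intros)
  have Pz0: "P z0 = 1" and Pp: "P p = 0" using k by (simp_all add: P_def)
  obtain M where M: "M > 0" "\<And>z. z \<in> ?Y \<Longrightarrow> norm (P z) \<le> M"
    using poly_approx_bounded[OF Y poly_approx_polynomial[OF P]] by blast
  define K' where "K' = K \<inter> {z. b\<^sup>2 / 8 \<le> norm (P z)}"
  have "closed {z. b\<^sup>2 / 8 \<le> norm (P z)}"
    by (intro closed_Collect_le continuous_intros holomorphic_polynomial_continuous_on P)
  then have K': "compact K'" unfolding K'_def using K by (intro compact_Int_closed)
  have nz: "Re (\<zeta> z) \<noteq> 0" if "z \<in> K'" for z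
  proof
    assume "Re (\<zeta> z) = 0"
    with that have "\<zeta> z = 0" using cone[of z] by (simp add: complex_eq_iff K'_def)
    then have "z = p" using zero that by (auto simp: K'_def)
    then show False using that Pp b by (simp add: K'_def)
  qed
  obtain \<mu> where \<mu>: "\<mu> > 0" "\<And>z. z \<in> K' \<Longrightarrow> \<bar>Re (\<zeta> z)\<bar> \<ge> \<mu>"
  proof (cases "K' = {}")
    case True then show thesis using that[of 1] by auto
  next
    case False
    then have "\<exists>x\<in>K'. \<forall>y\<in>K'. \<bar>Re (\<zeta> x)\<bar> \<le> \<bar>Re (\<zeta> y)\<bar>"
      by (intro continuous_attains_inf K' continuous_intros holomorphic_polynomial_continuous_on \<zeta>)
    then obtain x where "x \<in> K'" "\<And>y. y \<in> K' \<Longrightarrow> \<bar>Re (\<zeta> x)\<bar> \<le> \<bar>Re (\<zeta> y)\<bar>" by blast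
    then show thesis using that[of "\<bar>Re (\<zeta> x)\<bar>"] nz by auto
  qed
  \<comment> \<open>On \<open>K'\<close> one logistic factor is at most
    \<open>1 / (m * \<mu>)\<close> and the other at most \<open>1 / b\<close>; this \<open>m\<close>
    makes four times their product with \<open>M\<close> equal to \<open>1/2\<close>, the value that
    the threshold \<open>b\<^sup>2 / 8\<close> yields off \<open>K'\<close>.\<close>
  define m where "m = 8 * M / (b * \<mu>)"
  have m: "m > 0" using M \<mu> b by (simp add: m_def)
  define g where "g = (\<lambda>c z. 1 / (1 + exp (of_real (c * m) * \<zeta> z)))"
  have gb: "norm (g c z) \<le> 1 / b" if "z \<in> ?Y" for c z
  proof -
    have "\<bar>c * m\<bar> * \<bar>Im (\<zeta> z)\<bar> \<le> \<bar>c * m\<bar> * (C * \<bar>Re (\<zeta> z)\<bar>)"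
      using coneY[OF that] by (intro mult_left_mono) auto
    then have "b \<le> norm (1 + exp (of_real (c * m) * \<zeta> z))"
      by (intro b) (simp add: abs_mult ac_simps)
    then show ?thesis unfolding g_def using b(1) by (simp add: norm_divide frac_le)
  qed
  show ?thesis
  proof (intro exI conjI ballI)
    show "poly_approx ?Y (\<lambda>z. 4 * (g 1 z * g (-1) z * P z))"
      unfolding g_def
      by (intro poly_approx_mult Y poly_approx_logistic[where C = C] poly_approx_polynomial P \<zeta> coneY
          poly_approx_const)
    show "1/2 < norm (4 * (g 1 z0 * g (-1) z0 * P z0))"
      unfolding g_def Pz0 z0(2) by simp
    fix z assume z: "z \<in> K"
    show "norm (4 * (g 1 z * g (-1) z * P z)) \<le> 1/2"
    proof (cases "z \<in> K'")
      case False
      then have "norm (P z) \<le> b\<^sup>2 / 8"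
        using z by (auto simp: K'_def)
      then have "norm (g 1 z) * norm (g (-1) z) * norm (P z) \<le> (1 / b) * (1 / b) * (b\<^sup>2 / 8)"
        using gb[of z] z b by (intro mult_mono) auto
      then show ?thesis using b by (simp add: norm_mult power2_eq_square)
    next
      case True
      have ge: "m * \<bar>Re (\<zeta> z)\<bar> \<ge> m * \<mu>" using \<mu>(2)[OF True] m by simp
      have "norm (g 1 z) * norm (g (-1) z) \<le> (1 / (m * \<mu>)) * (1 / b)"
      proof (cases "Re (\<zeta> z) \<ge> 0")
        case pos: True
        have "norm (g 1 z) \<le> 1 / (m * \<mu>)"
          unfolding g_def using m \<mu>(1) ge pos by (intro norm_inverse_one_plus_exp_le) auto
        then show ?thesis using gb[of z "-1"] z m \<mu> by (intro mult_mono) auto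
      next
        case neg: False
        have "norm (g (-1) z) \<le> 1 / (m * \<mu>)"
          unfolding g_def using m \<mu>(1) ge neg by (intro norm_inverse_one_plus_exp_le) auto
        then have "norm (g (-1) z) * norm (g 1 z) \<le> (1 / (m * \<mu>)) * (1 / b)"
          using gb[of z 1] z m \<mu> by (intro mult_mono) auto
        then show ?thesis by (simp add: mult.commute)
      qed
      then have "norm (g 1 z) * norm (g (-1) z) * norm (P z) \<le> (1 / (m * \<mu>)) * (1 / b) * M"
        using M z m \<mu> b by (intro mult_mono[of "norm (g 1 z) * norm (g (-1) z)"]) auto
      also have "\<dots> = 1/8" using M \<mu> b by (simp add: m_def)
      finally show ?thesis by (simp add: norm_mult)
    qed
  qed
qed

text \<open>The double sector meets the imaginary axis only at \<open>0\<close>, so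
  \<open>t * \<zeta> - \<zeta> z0\<close> has no zero on \<open>K\<close> along the whole path from
  the constant \<open>- \<zeta> z0\<close>. If \<open>R\<close> approximates the reciprocal of
  \<open>\<zeta> - \<zeta> z0\<close>, then \<open>1 - (\<zeta> - \<zeta> z0) * R\<close> is small
  on \<open>K\<close> and \<open>1\<close> at \<open>z0\<close>.\<close>

lemma kallin_imaginary:
  fixes K :: "(complex ^ 'n) set"
  assumes K: "compact K" and \<zeta>: "holomorphic_polynomial \<zeta>"
    and cone: "\<And>z. z \<in> K \<Longrightarrow> \<bar>Im (\<zeta> z)\<bar> \<le> C * \<bar>Re (\<zeta> z)\<bar>"
    and z0: "Re (\<zeta> z0) = 0" "\<zeta> z0 \<noteq> 0"
  shows "\<exists>f a. poly_approx (insert z0 K) f \<and> (\<forall>z\<in>K. norm (f z) \<le> a) \<and> a < norm (f z0)"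
proof -
  let ?D = "\<lambda>t z. of_real t * \<zeta> z - \<zeta> z0"
  have "poly_approx K (\<lambda>z. 1 / ?D 1 z)"
  proof (rule poly_approx_inverse_homotopy[OF K])
    have "continuous_on ({0..1} \<times> K) (\<lambda>x. \<zeta> (snd x))"
      by (rule continuous_on_compose2[OF holomorphic_polynomial_continuous_on[OF \<zeta>, of UNIV]])
        (auto intro: continuous_intros)
    then show "continuous_on ({0..1} \<times> K) (\<lambda>(t, z). ?D t z)"
      unfolding case_prod_unfold by (intro continuous_intros)
    fix t :: real and z assume z: "z \<in> K"
    show "?D t z \<noteq> 0"
    proof
      assume D0: "?D t z = 0"
      then have eq: "of_real t * \<zeta> z = \<zeta> z0" by simp
      have "t * Re (\<zeta> z) = 0" using arg_cong[OF eq, of Re] z0 by simp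
      then have "t = 0 \<or> \<zeta> z = 0" using cone[OF z] by (auto simp: complex_eq_iff)
      then show False using eq z0 by auto
    qed
  next
    fix t :: real
    show "poly_approx K (?D t)"
      by (intro poly_approx_polynomial holomorphic_polynomial_intros \<zeta>)
  next
    show "poly_approx K (\<lambda>z. 1 / ?D 0 z)" by (simp add: poly_approx_const)
  qed
  then have inv: "poly_approx K (\<lambda>z. 1 / (\<zeta> z - \<zeta> z0))" by simp
  have nz: "\<zeta> z \<noteq> \<zeta> z0" if "z \<in> K" for z
  proof
    assume eq: "\<zeta> z = \<zeta> z0"
    then have "\<zeta> z = 0" using cone[OF that] z0 by (simp add: complex_eq_iff)
    then show False using eq z0 by simp
  qed
  have pol: "holomorphic_polynomial (\<lambda>z. \<zeta> z - \<zeta> z0)" by (intro holomorphic_polynomial_intros \<zeta>)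
  obtain M where M: "M > 0" "\<And>z. z \<in> K \<Longrightarrow> norm (\<zeta> z - \<zeta> z0) \<le> M"
    using poly_approx_bounded[OF K poly_approx_polynomial[OF pol]] by blast
  \<comment> \<open>Approximation on \<open>K\<close> alone suffices: at \<open>z0\<close> the
    factor \<open>\<zeta> - \<zeta> z0\<close> vanishes, whatever \<open>R z0\<close> is.\<close>
  obtain R where R: "holomorphic_polynomial R"
    "\<And>z. z \<in> K \<Longrightarrow> norm (1 / (\<zeta> z - \<zeta> z0) - R z) \<le> 1 / (2 * M)"
    using poly_approxE[OF inv, of "1 / (2 * M)"] M by auto
  show ?thesis
  proof (intro exI conjI ballI)
    show "poly_approx (insert z0 K) (\<lambda>z. 1 - (\<zeta> z - \<zeta> z0) * R z)"
      by (intro poly_approx_polynomial holomorphic_polynomial_intros \<zeta> R)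
    show "1/2 < norm (1 - (\<zeta> z0 - \<zeta> z0) * R z0)" by simp
    fix z assume z: "z \<in> K"
    have "1 - (\<zeta> z - \<zeta> z0) * R z = (\<zeta> z - \<zeta> z0) * (1 / (\<zeta> z - \<zeta> z0) - R z)"
      using nz[OF z] by (simp add: right_diff_distrib)
    also have "norm \<dots> \<le> M * (1 / (2 * M))"
      unfolding norm_mult using M R(2)[OF z] z by (intro mult_mono) auto
    also have "\<dots> = 1/2" using M by simp
    finally show "norm (1 - (\<zeta> z - \<zeta> z0) * R z) \<le> 1/2" .
  qed
qed

text \<open>The position of \<open>\<zeta> z0\<close> decides: one of the open half-planes
  (exchanged by the sign of \<open>\<zeta>\<close>), the punctured imaginary axis, or
  \<open>0\<close>. By \<open>zero\<close> and the two cone conditions, the fibre over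
  \<open>0\<close> in the union is the single point \<open>p\<close>, a special case of the
  polynomially convex fibre in the usual form of the lemma.\<close>

theorem kallin:
  fixes K1 K2 :: "(complex ^ 'n) set"
  assumes K1: "polynomially_convex K1" and K2: "polynomially_convex K2" and p: "p \<in> K1" "p \<in> K2"
    and \<zeta>: "holomorphic_polynomial \<zeta>"
    and cone1: "\<And>z. z \<in> K1 \<Longrightarrow> \<bar>Im (\<zeta> z)\<bar> \<le> C * - Re (\<zeta> z)"
    and cone2: "\<And>z. z \<in> K2 \<Longrightarrow> \<bar>Im (\<zeta> z)\<bar> \<le> C * Re (\<zeta> z)"
    and C: "C > 0"
    and zero: "\<And>z. z \<in> K1 \<union> K2 \<Longrightarrow> \<zeta> z = 0 \<Longrightarrow> z = p"
  shows "polynomially_convex (K1 \<union> K2)"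
proof (rule polynomially_convexI)
  have c: "compact K1" "compact K2" using K1 K2 by (auto simp: polynomially_convex_def)
  then show K: "compact (K1 \<union> K2)" by (rule compact_Un)
  have cone: "\<bar>Im (\<zeta> z)\<bar> \<le> C * \<bar>Re (\<zeta> z)\<bar>" if "z \<in> K1 \<union> K2" for z
  proof -
    have "C * - Re (\<zeta> z) \<le> C * \<bar>Re (\<zeta> z)\<bar>" "C * Re (\<zeta> z) \<le> C * \<bar>Re (\<zeta> z)\<bar>"
      using C by (intro mult_left_mono; simp)+
    then show ?thesis using that cone1[of z] cone2[of z] by (auto simp del: mult_minus_right)
  qed
  fix z0 assume z0: "z0 \<notin> K1 \<union> K2"
  consider "Re (\<zeta> z0) > 0" | "Re (\<zeta> z0) < 0" | "Re (\<zeta> z0) = 0" "\<zeta> z0 \<noteq> 0" | "\<zeta> z0 = 0" by fastforce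
  then show "\<exists>f a. poly_approx (insert z0 (K1 \<union> K2)) f \<and>
      (\<forall>z\<in>K1 \<union> K2. norm (f z) \<le> a) \<and> a < norm (f z0)"
  proof cases
    case 1
    show ?thesis
      by (rule kallin_half[OF c(1) K2 p(2) \<zeta> cone1 cone2 C zero]) (use z0 1 in auto)
  next
    case 2
    have \<zeta>': "holomorphic_polynomial (\<lambda>z. 0 - \<zeta> z)" by (intro holomorphic_polynomial_intros \<zeta>)
    have "\<exists>f a. poly_approx (insert z0 (K2 \<union> K1)) f \<and>
      (\<forall>z\<in>K2 \<union> K1. norm (f z) \<le> a) \<and> a < norm (f z0)"
      by (rule kallin_half[OF c(2) K1 p(1) \<zeta>' _ _ C]) (use z0 2 cone1 cone2 zero in auto)
    then show ?thesis by (simp add: Un_commute)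
  next
    case 3
    then show ?thesis by (intro kallin_imaginary[OF K \<zeta> cone])
  next
    case 4
    then show ?thesis using z0 p by (intro kallin_zero[OF K \<zeta> cone zero]) auto
  qed
qed

subsection \<open>The quadratic form of a Lagrangian plane\<close>

text \<open>The conjugate is on the second argument, so that
  \<open>z \<mapsto> hermitian_product z w\<close> is a holomorphic polynomial.\<close>

definition hermitian_product :: "complex ^ 'n \<Rightarrow> complex ^ 'n \<Rightarrow> complex" where
  "hermitian_product z w = (\<Sum>k\<in>UNIV. z $ k * cnj (w $ k))"

lemma inner_complex_vec: "u \<bullet> v = (\<Sum>k\<in>UNIV. Re (u $ k) * Re (v $ k) + Im (u $ k) * Im (v $ k))"
  for u v :: "complex ^ 'n"
  by (simp add: inner_vec_def inner_complex_def)

lemma Re_hermitian_product: "Re (hermitian_product z w) = z \<bullet> w"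
  by (simp add: hermitian_product_def inner_complex_vec)

lemma Im_hermitian_product: "Im (hermitian_product z w) = z \<bullet> (\<i> *s w)"
  by (simp add: hermitian_product_def inner_complex_vec algebra_simps)

text \<open>Vanishing of \<open>symplectic_form\<close> on \<open>T\<close> thus says that
  \<open>\<i> T\<close> is orthogonal to \<open>T\<close>, the form in which the Lagrangian
  condition enters the linear algebra.\<close>

lemma inner_i_scale: "u \<bullet> (\<i> *s v) = - symplectic_form u v"
  by (simp add: inner_complex_vec symplectic_form_def algebra_simps sum_negf[symmetric])

lemma inner_i_scale_both: "(\<i> *s u) \<bullet> (\<i> *s v) = u \<bullet> v" for u v :: "complex ^ 'n"
  by (simp add: inner_complex_vec add.commute)

lemma orthonormal_spanning_expansion:
  fixes B :: "'a::euclidean_space set"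
  assumes B: "pairwise orthogonal B" "\<And>b. b \<in> B \<Longrightarrow> norm b = 1" "span B = UNIV"
  shows "(\<Sum>b\<in>B. (z \<bullet> b) *\<^sub>R b) = z"
proof -
  have "finite B" using B(1) pairwise_orthogonal_imp_finite by blast
  have "orthogonal (z - (\<Sum>b\<in>B. (z \<bullet> b) *\<^sub>R b)) a" if "a \<in> B" for a
  proof -
    have "(\<Sum>b\<in>B. (z \<bullet> b) *\<^sub>R b) \<bullet> a = (\<Sum>b\<in>B. (z \<bullet> b) * (b \<bullet> a))"
      by (simp add: inner_sum_left)
    also have "\<dots> = (\<Sum>b\<in>B. if b = a then z \<bullet> a else 0)"
    proof (rule sum.cong)
      fix b assume "b \<in> B"
      then show "(z \<bullet> b) * (b \<bullet> a) = (if b = a then z \<bullet> a else 0)"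
        using B(1,2) that by (auto simp: pairwise_def orthogonal_def dot_square_norm)
    qed simp
    also have "\<dots> = z \<bullet> a" using that \<open>finite B\<close> by simp
    finally show ?thesis by (simp add: orthogonal_def inner_diff_left)
  qed
  then have "orthogonal (z - (\<Sum>b\<in>B. (z \<bullet> b) *\<^sub>R b)) (z - (\<Sum>b\<in>B. (z \<bullet> b) *\<^sub>R b))"
    using orthogonal_to_span[of _ B] B(3) by blast
  then show ?thesis by (simp add: orthogonal_self)
qed

lemma norm_sum_orthonormal:
  fixes B :: "'a::euclidean_space set"
  assumes B: "pairwise orthogonal B" "\<And>b. b \<in> B \<Longrightarrow> norm b = 1"
  shows "(norm (\<Sum>b\<in>B. c b *\<^sub>R b))\<^sup>2 = (\<Sum>b\<in>B. (c b)\<^sup>2)"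
proof -
  have "finite B" using B(1) pairwise_orthogonal_imp_finite by blast
  then have "(norm (\<Sum>b\<in>B. c b *\<^sub>R b))\<^sup>2 = (\<Sum>b\<in>B. (norm (c b *\<^sub>R b))\<^sup>2)"
    using B(1) by (intro norm_sum_Pythagorean) (auto simp: pairwise_def orthogonal_def)
  then show ?thesis using B(2) by simp
qed

text \<open>
  If \<open>e\<^sub>1, \<dots>, e\<^sub>n\<close> is an orthonormal basis of the Lagrangian plane \<open>T\<close>, then it is a unitary basis
  of the ambient space, and \<open>Q z = \<Sum>\<^sub>j \<langle>z, e\<^sub>j\<rangle>\<^sup>2\<close>; the orthogonal complement of \<open>T\<close> is \<open>i T\<close>.
\<close>
lemma lagrangian_plane_form:
  fixes T :: "(complex ^ 'n) set"
  assumes T: "subspace T" "dim T = CARD('n)"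
    and iso: "\<And>u v. u \<in> T \<Longrightarrow> v \<in> T \<Longrightarrow> symplectic_form u v = 0"
  obtains Q where "\<And>c. holomorphic_polynomial (\<lambda>z. Q (z - c))"
    and "\<And>a z. Q (a *\<^sub>R z) = of_real (a\<^sup>2) * Q z"
    and "\<And>z. norm (Q z) \<le> (norm z)\<^sup>2"
    and "\<And>z u. u \<in> T \<Longrightarrow> Re (Q z) \<ge> (norm z)\<^sup>2 - 2 * (norm (z - u))\<^sup>2"
    and "\<And>z. \<exists>u\<in>T. Re (Q z) = (norm z)\<^sup>2 - 2 * (norm (z - u))\<^sup>2"
proof -
  obtain B where B: "B \<subseteq> T" "pairwise orthogonal B" "\<And>b. b \<in> B \<Longrightarrow> norm b = 1"
      "independent B" "card B = dim T" "span B = T"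
    using orthonormal_basis_subspace[OF T(1)] by metis
  have finB: "finite B" using B(2) pairwise_orthogonal_imp_finite by blast
  define J where "J = (\<lambda>v :: complex ^ 'n. \<i> *s v)"
  define S where "S = B \<union> J ` B"
  have J: "orthogonal b (J a)" "orthogonal (J a) b" if "a \<in> B" "b \<in> B" for a b
    using iso[of b a] that B(1) by (auto simp: orthogonal_def J_def inner_i_scale inner_commute)
  have normJ: "norm (J a) = norm a" for a
    by (simp add: J_def norm_eq_sqrt_inner inner_i_scale_both)
  have injJ: "inj J" by (auto simp: J_def inj_def vec_eq_iff)
  have orthS: "pairwise orthogonal S"
  proof (rule pairwiseI)
    fix x y assume "x \<in> S" "y \<in> S" "x \<noteq> y"
    then show "orthogonal x y"
      using B(2) J by (auto simp: S_def pairwise_def orthogonal_def J_def inner_i_scale_both)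
  qed
  have normS: "norm b = 1" if "b \<in> S" for b using that B(3) normJ by (auto simp: S_def)
  have disj: "B \<inter> J ` B = {}"
  proof -
    have False if "b \<in> B" "b = J a" "a \<in> B" for a b
      using J(1)[OF that(3,1)] B(3)[OF that(1)] that(2) by (simp add: orthogonal_self)
    then show ?thesis by blast
  qed
  \<comment> \<open>Here the dimension of a Lagrangian plane enters: \<open>2 * CARD('n)\<close>
    orthonormal vectors span the ambient space over the reals.\<close>
  have "card S = 2 * CARD('n)"
    using finB disj injJ B(5) T(2) by (simp add: S_def card_Un_disjoint card_image inj_on_subset)
  moreover have "independent S"
    using normS by (intro pairwise_orthogonal_independent orthS) force
  ultimately have spanS: "span S = UNIV"
    using card_ge_dim_independent[of S UNIV] by auto
  have split: "(\<Sum>b\<in>S. h b) = (\<Sum>b\<in>B. h b) + (\<Sum>b\<in>B. h (J b))"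
    for h :: "complex ^ 'n \<Rightarrow> 'b::comm_monoid_add"
    unfolding S_def using finB disj injJ
    by (simp add: sum.union_disjoint sum.reindex inj_on_subset)
  define Q where "Q = (\<lambda>z. \<Sum>b\<in>B. (hermitian_product z b)\<^sup>2)"
  define \<pi> where "\<pi> = (\<lambda>z. \<Sum>b\<in>B. (z \<bullet> b) *\<^sub>R b)"
  have \<pi>T: "\<pi> z \<in> T" for z
    unfolding \<pi>_def using B(1) by (intro subspace_sum T subspace_scale) auto
  have rest: "z - \<pi> z = (\<Sum>b\<in>B. (z \<bullet> J b) *\<^sub>R J b)" for z
    using orthonormal_spanning_expansion[OF orthS normS spanS, of z] split[of "\<lambda>b. (z \<bullet> b) *\<^sub>R b"]
    by (simp add: \<pi>_def algebra_simps)
  have n1: "(norm (\<pi> z))\<^sup>2 = (\<Sum>b\<in>B. (z \<bullet> b)\<^sup>2)" for z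
    unfolding \<pi>_def by (rule norm_sum_orthonormal[OF B(2,3)])
  have n: "(norm z)\<^sup>2 = (\<Sum>b\<in>B. (z \<bullet> b)\<^sup>2) + (\<Sum>b\<in>B. (z \<bullet> J b)\<^sup>2)" for z
    using norm_sum_orthonormal[OF orthS normS, of "\<lambda>b. z \<bullet> b"]
      orthonormal_spanning_expansion[OF orthS normS spanS, of z] split[of "\<lambda>b. (z \<bullet> b)\<^sup>2"] by simp
  have orth: "orthogonal (z - \<pi> z) u" if "u \<in> T" for z u
  proof (rule orthogonal_to_span)
    show "u \<in> span B" using that B(6) by simp
    show "orthogonal (z - \<pi> z) b" if "b \<in> B" for b
      unfolding rest using J that by (auto simp: orthogonal_def inner_sum_left)
  qed
  have pyth: "(norm (z - u))\<^sup>2 = (norm (z - \<pi> z))\<^sup>2 + (norm (\<pi> z - u))\<^sup>2" if "u \<in> T" for z u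
  proof -
    have "\<pi> z - u \<in> T" using \<pi>T that T(1) subspace_diff by blast
    from norm_add_Pythagorean[OF orth[OF this, of z]] show ?thesis by simp
  qed
  have n2: "(norm (z - \<pi> z))\<^sup>2 = (\<Sum>b\<in>B. (z \<bullet> J b)\<^sup>2)" for z
    using pyth[of 0 z] n[of z] n1[of z] subspace_0[OF T(1)] by simp
  \<comment> \<open>\<open>(hermitian_product z b)\<^sup>2\<close> has real part
    \<open>(z \<bullet> b)\<^sup>2 - (z \<bullet> J b)\<^sup>2\<close>, so \<open>Re (Q z)\<close>
    is the squared norm of the component along \<open>T\<close> minus that of the component
    orthogonal to it.\<close>
  have ReQ: "Re (Q z) = (norm z)\<^sup>2 - 2 * (norm (z - \<pi> z))\<^sup>2" for z
    unfolding Q_def n2 n[of z]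
    by (simp add: Re_power2 Re_hermitian_product Im_hermitian_product J_def sum_subtractf)
  show thesis
  proof (rule that[of Q])
    show "holomorphic_polynomial (\<lambda>z. Q (z - c))" for c
      unfolding Q_def hermitian_product_def vector_minus_component
      by (intro holomorphic_polynomial_intros)
    have "hermitian_product (a *\<^sub>R z) b = of_real a * hermitian_product z b" for a and z b :: "complex ^ 'n"
      unfolding hermitian_product_def vector_scaleR_component
      by (simp add: scaleR_conv_of_real sum_distrib_left mult.assoc)
    then show "Q (a *\<^sub>R z) = of_real (a\<^sup>2) * Q z" for a z
      by (simp add: Q_def power_mult_distrib sum_distrib_left)
    show "norm (Q z) \<le> (norm z)\<^sup>2" for z
    proof -
      have "norm (Q z) \<le> (\<Sum>b\<in>B. norm ((hermitian_product z b)\<^sup>2))" unfolding Q_def by (rule norm_sum)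
      also have "\<dots> = (norm z)\<^sup>2"
        unfolding n by (simp add: norm_power cmod_power2 Re_hermitian_product Im_hermitian_product
            J_def sum.distrib)
      finally show ?thesis .
    qed
    \<comment> \<open>\<open>\<pi> z\<close> is the nearest point of \<open>T\<close>, so any other
      \<open>u\<close> only lowers the right-hand side.\<close>
    show "Re (Q z) \<ge> (norm z)\<^sup>2 - 2 * (norm (z - u))\<^sup>2" if "u \<in> T" for z u
      unfolding ReQ pyth[OF that, of z] by simp
    show "\<exists>u\<in>T. Re (Q z) = (norm z)\<^sup>2 - 2 * (norm (z - u))\<^sup>2" for z
      using ReQ \<pi>T by blast
  qed
qed

subsection \<open>Local structure of submanifolds\<close>

lemma Ck_on_cong:
  assumes "open S" "\<And>x. x \<in> S \<Longrightarrow> f x = g x" "Ck_on k f S"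
  shows "Ck_on k g S"
  using assms(2,3)
proof (induction k arbitrary: f g)
  case 0
  then show ?case by (simp cong: continuous_on_cong)
next
  case (Suc k)
  have der: "(g has_derivative frechet_derivative f (at x)) (at x)" if "x \<in> S" for x
  proof (rule has_derivative_transform_within_open[OF _ \<open>open S\<close> that])
    show "(f has_derivative frechet_derivative f (at x)) (at x)"
      using Suc.prems(2) that by (simp flip: frechet_derivative_works)
  qed (rule Suc.prems(1))
  have eq: "frechet_derivative g (at x) = frechet_derivative f (at x)" if "x \<in> S" for x
    using frechet_derivative_at[OF der[OF that]] by simp
  have "Ck_on k (\<lambda>x. frechet_derivative g (at x) v) S" for v
    by (rule Suc.IH[of "\<lambda>x. frechet_derivative f (at x) v"]) (use Suc.prems eq in auto)
  then show ?case using der by (auto simp: differentiable_def)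
qed

text \<open>This makes images of line segments under a chart smooth curves. As the inner map is
  affine, each derivative is again some function evaluated at \<open>a + t *\<^sub>R b\<close>, and
  the induction closes without a product rule.\<close>

lemma Ck_on_affine:
  fixes f :: "'a::euclidean_space \<Rightarrow> 'b::euclidean_space" and I :: "real set"
  assumes "open I" "\<And>t. t \<in> I \<Longrightarrow> a + t *\<^sub>R b \<in> S" "Ck_on k f S"
  shows "Ck_on k (\<lambda>t. f (a + t *\<^sub>R b)) I"
  using assms(3)
proof (induction k arbitrary: f)
  case 0
  then show ?case
    using assms(2) by (auto intro!: continuous_intros continuous_on_compose2[of S f])
next
  case (Suc k)
  have der: "((\<lambda>t. f (a + t *\<^sub>R b)) has_derivative
      (\<lambda>s. frechet_derivative f (at (a + t *\<^sub>R b)) (s *\<^sub>R b))) (at t)" if "t \<in> I" for t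
  proof -
    have "(f has_derivative frechet_derivative f (at (a + t *\<^sub>R b))) (at (a + t *\<^sub>R b))"
      using Suc.prems assms(2)[OF that] by (simp flip: frechet_derivative_works)
    moreover have "((\<lambda>t. a + t *\<^sub>R b) has_derivative (\<lambda>s. s *\<^sub>R b)) (at t)"
      by (auto intro!: derivative_eq_intros)
    ultimately show ?thesis using has_derivative_compose by blast
  qed
  have "Ck_on k (\<lambda>t. frechet_derivative (\<lambda>t. f (a + t *\<^sub>R b)) (at t) s) I" for s
  proof (rule Ck_on_cong[OF \<open>open I\<close>])
    show "Ck_on k (\<lambda>t. frechet_derivative f (at (a + t *\<^sub>R b)) (s *\<^sub>R b)) I"
      using Suc.IH[of "\<lambda>x. frechet_derivative f (at x) (s *\<^sub>R b)"] Suc.prems by simp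
    show "frechet_derivative f (at (a + t *\<^sub>R b)) (s *\<^sub>R b) =
        frechet_derivative (\<lambda>t. f (a + t *\<^sub>R b)) (at t) s" if "t \<in> I" for t
      using fun_cong[OF frechet_derivative_at[OF der[OF that]], of s] by simp
  qed
  then show ?case using der by (auto simp: differentiable_def)
qed

lemma smooth_on_has_derivative:
  assumes "smooth_on f S" "x \<in> S"
  shows "(f has_derivative frechet_derivative f (at x)) (at x)"
proof -
  have "Ck_on 1 f S" using assms(1) by (simp add: smooth_on_def)
  then show ?thesis using assms(2) by (simp flip: frechet_derivative_works)
qed

text \<open>Strict differentiability: the mean value inequality is applied to \<open>f\<close> minus
  its linear part at \<open>x\<close>, whose derivative is small near \<open>x\<close> because the
  partial derivatives are continuous. Neither \<open>y\<close> nor \<open>z\<close> need be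
  \<open>x\<close>.\<close>

lemma smooth_on_strictly_differentiable:
  fixes f :: "'a::euclidean_space \<Rightarrow> 'b::euclidean_space"
  assumes f: "smooth_on f S" and S: "open S" "x \<in> S" and \<eta>: "\<eta> > 0"
  obtains r where "r > 0" "cball x r \<subseteq> S"
    "\<And>y z. y \<in> cball x r \<Longrightarrow> z \<in> cball x r \<Longrightarrow>
      norm (f y - f z - frechet_derivative f (at x) (y - z)) \<le> \<eta> * norm (y - z)"
proof -
  let ?D = "\<lambda>y. frechet_derivative f (at y)"
  have "Ck_on 1 f S" using f by (simp add: smooth_on_def)
  then have cont: "continuous_on S (\<lambda>y. ?D y v)" for v by simp
  \<comment> \<open>The deviation allowed in each basis direction; summing over the basis gives
    operator norm at most \<open>\<eta>\<close>.\<close>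
  define \<delta> where "\<delta> = \<eta> / DIM('a)"
  have \<delta>: "\<delta> > 0" using \<eta> by (simp add: \<delta>_def)
  have "eventually (\<lambda>y. norm (?D y i - ?D x i) < \<delta>) (nhds x)" for i
  proof -
    have "isCont (\<lambda>y. ?D y i) x" using cont S by (simp add: continuous_on_eq_continuous_at)
    then have "((\<lambda>y. ?D y i) \<longlongrightarrow> ?D x i) (nhds x)" 
      unfolding isCont_def tendsto_at_iff_tendsto_nhds[of "\<lambda>y. ?D y i"] .
    from tendstoD[OF this \<delta>] show ?thesis by (simp add: dist_norm)
  qed
  then have "eventually (\<lambda>y. \<forall>i\<in>Basis. norm (?D y i - ?D x i) < \<delta>) (nhds x)"
    by (simp add: eventually_ball_finite)
  moreover have "eventually (\<lambda>y. y \<in> S) (nhds x)" using S by (rule eventually_nhds_in_open)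
  ultimately have "eventually (\<lambda>y. y \<in> S \<and> (\<forall>i\<in>Basis. norm (?D y i - ?D x i) < \<delta>)) (nhds x)"
    by eventually_elim auto
  then obtain e where e: "e > 0" "\<And>y. dist y x < e \<Longrightarrow> y \<in> S \<and> (\<forall>i\<in>Basis. norm (?D y i - ?D x i) < \<delta>)"
    unfolding eventually_nhds_metric by blast
  have ball: "y \<in> S" "\<And>i. i \<in> Basis \<Longrightarrow> norm (?D y i - ?D x i) \<le> \<delta>" if "y \<in> cball x (e/2)" for y
    using e(2)[of y] that e(1) by (auto simp: dist_commute less_imp_le)
  have lin: "linear (?D y)" if "y \<in> S" for y
    using smooth_on_has_derivative[OF f that] has_derivative_linear by blast
  have on: "onorm (\<lambda>v. ?D y v - ?D x v) \<le> \<eta>" if y: "y \<in> cball x (e/2)" for y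
  proof (rule onorm_le)
    fix v
    interpret D: linear "\<lambda>v. ?D y v - ?D x v"
      using lin[OF ball(1)[OF y]] lin[OF S(2)] by (rule linear_compose_sub)
    have "?D y v - ?D x v = (\<Sum>i\<in>Basis. (v \<bullet> i) *\<^sub>R (?D y i - ?D x i))"
      using D.sum[of "\<lambda>i. (v \<bullet> i) *\<^sub>R i" Basis] D.scaleR
      by (simp add: euclidean_representation)
    also have "norm \<dots> \<le> (\<Sum>i\<in>(Basis::'a set). norm v * \<delta>)"
      by (rule sum_norm_le) (auto intro!: mult_mono ball(2)[OF y] Basis_le_norm)
    also have "\<dots> = \<eta> * norm v" by (simp add: \<delta>_def)
    finally show "norm (?D y v - ?D x v) \<le> \<eta> * norm v" .
  qed
  show thesis
  proof (rule that[of "e/2"])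
    show "e/2 > 0" using e(1) by simp
    show "cball x (e/2) \<subseteq> S" using ball by blast
    fix y z assume y: "y \<in> cball x (e/2)" and z: "z \<in> cball x (e/2)"
    have "norm ((f y - ?D x y) - (f z - ?D x z)) \<le> \<eta> * norm (y - z)"
    proof (rule differentiable_bound[OF convex_cball _ on y z])
      fix w assume w: "w \<in> cball x (e/2)"
      have "(?D x has_derivative ?D x) (at w within cball x (e/2))"
        by (intro linear_imp_has_derivative lin S)
      then show "((\<lambda>y. f y - ?D x y) has_derivative (\<lambda>v. ?D w v - ?D x v)) (at w within cball x (e/2))"
        by (intro has_derivative_diff has_derivative_at_withinI[OF smooth_on_has_derivative[OF f ball(1)[OF w]]])
    qed
    then show "norm (f y - f z - ?D x (y - z)) \<le> \<eta> * norm (y - z)"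
      by (simp add: linear_diff[OF lin[OF S(2)]] algebra_simps)
  qed
qed

text \<open>All claims are read off from one slice chart, in which \<open>M\<close> becomes the
  linear space \<open>E\<close>. Secants of \<open>M\<close> are differences of
  \<open>\<psi>\<close> along secants of \<open>E\<close>, and \<open>\<psi>\<close> is strictly
  differentiable at the image of \<open>p\<close>, so they are nearly tangent vectors at
  \<open>p\<close>. The last claim is a converse: from any \<open>c\<close> near \<open>p\<close>,
  \<open>M\<close> can be followed in the direction of a tangent vector at \<open>p\<close>, not at
  \<open>c\<close>.\<close>

lemma smooth_submanifold_local:
  fixes M :: "'a::euclidean_space set"
  assumes M: "smooth_submanifold d M" and p: "p \<in> M"
  shows subspace_tangent_space: "subspace (tangent_space M p)"
    and dim_tangent_space: "dim (tangent_space M p) = d"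
    and smooth_submanifold_locally_closed: "\<exists>r>0. closed (M \<inter> cball p r)"
    and smooth_submanifold_nearly_flat:
      "\<And>\<eta>. \<eta> > 0 \<Longrightarrow> \<exists>r>0. \<forall>y\<in>M \<inter> cball p r. \<forall>z\<in>M \<inter> cball p r.
         \<exists>u\<in>tangent_space M p. norm (y - z - u) \<le> \<eta> * norm (y - z)"
    and smooth_submanifold_move:
      "\<And>\<eta>. \<eta> > 0 \<Longrightarrow> \<exists>r>0. \<forall>c\<in>M \<inter> cball p r. \<forall>u\<in>tangent_space M p.
         \<exists>\<delta>>0. \<forall>t. 0 < t \<and> t < \<delta> \<longrightarrow> (\<exists>z\<in>M. norm (z - c - t *\<^sub>R u) \<le> \<eta> * t * norm u)"
proof -
  obtain U V and \<phi> \<psi> :: "'a \<Rightarrow> 'a" and E where U: "open U" "p \<in> U" and V: "open V"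
    and hom: "homeomorphism U V \<phi> \<psi>" and sm: "smooth_on \<phi> U" "smooth_on \<psi> V"
    and E: "subspace E" "dim E = d" and img: "\<phi> ` (M \<inter> U) = E \<inter> V"
    using M p unfolding smooth_submanifold_def by metis
  have UV: "\<And>x. x \<in> U \<Longrightarrow> \<phi> x \<in> V" "\<And>x. x \<in> U \<Longrightarrow> \<psi> (\<phi> x) = x"
    "\<And>y. y \<in> V \<Longrightarrow> \<psi> y \<in> U" "\<And>y. y \<in> V \<Longrightarrow> \<phi> (\<psi> y) = y"
    using hom by (auto simp: homeomorphism_def)
  have mem: "x \<in> M \<longleftrightarrow> \<phi> x \<in> E" if "x \<in> U" for x
  proof
    assume "x \<in> M" then show "\<phi> x \<in> E" using img that by blast
  next
    assume "\<phi> x \<in> E"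
    then have "\<phi> x \<in> \<phi> ` (M \<inter> U)" using img UV(1)[OF that] by blast
    then obtain x' where "x' \<in> M" "x' \<in> U" "\<phi> x = \<phi> x'" by blast
    then show "x \<in> M" using UV(2) that by metis
  qed
  define a where "a = \<phi> p"
  have a: "a \<in> V" "a \<in> E" "\<psi> a = p" using UV U mem p by (auto simp: a_def)
  define A where "A = frechet_derivative \<phi> (at p)"
  define B where "B = frechet_derivative \<psi> (at a)"
  have A: "(\<phi> has_derivative A) (at p)" unfolding A_def by (rule smooth_on_has_derivative[OF sm(1) U(2)])
  have B: "(\<psi> has_derivative B) (at a)" unfolding B_def by (rule smooth_on_has_derivative[OF sm(2) a(1)])
  have linA: "linear A" and linB: "linear B" using A B has_derivative_linear by blast+
  have BA: "B (A v) = v" for v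
  proof -
    have "((\<lambda>x. \<psi> (\<phi> x)) has_derivative (\<lambda>v. B (A v))) (at p)"
      using has_derivative_compose[OF A] B by (simp add: a_def)
    moreover have "((\<lambda>x. \<psi> (\<phi> x)) has_derivative (\<lambda>v. v)) (at p)"
      by (rule has_derivative_transform_within_open[OF has_derivative_ident U]) (simp add: UV)
    ultimately show ?thesis using has_derivative_unique by metis
  qed
  have AB: "A (B v) = v" for v
  proof -
    have "((\<lambda>x. \<phi> (\<psi> x)) has_derivative (\<lambda>v. A (B v))) (at a)"
      using has_derivative_compose[OF B] A by (simp add: a(3))
    moreover have "((\<lambda>x. \<phi> (\<psi> x)) has_derivative (\<lambda>v. v)) (at a)"
      by (rule has_derivative_transform_within_open[OF has_derivative_ident V a(1)]) (simp add: UV)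
    ultimately show ?thesis using has_derivative_unique by metis
  qed
  \<comment> \<open>One inclusion: the difference quotients of
    \<open>\<phi> \<circ> \<gamma>\<close> at \<open>0\<close> eventually lie in \<open>E\<close>,
    which is closed. The other: \<open>\<psi>\<close> maps segments in \<open>E\<close> through
    \<open>a\<close> to curves in \<open>M\<close>.\<close>
  have T: "tangent_space M p = B ` E"
  proof (intro equalityI subsetI)
    fix v assume "v \<in> tangent_space M p"
    then obtain \<gamma> e where \<gamma>: "e > 0" "\<gamma> ` {-e<..<e} \<subseteq> M" "\<gamma> 0 = p" "(\<gamma> has_vector_derivative v) (at 0)"
      by (auto simp: tangent_space_def)
    have "(\<gamma> has_derivative (\<lambda>t. t *\<^sub>R v)) (at 0)" using \<gamma>(4) by (simp add: has_vector_derivative_def)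
    then have "((\<lambda>t. \<phi> (\<gamma> t)) has_derivative (\<lambda>t. A (t *\<^sub>R v))) (at 0)"
      using has_derivative_compose A \<gamma>(3) by blast
    then have "((\<lambda>h. norm (\<phi> (\<gamma> h) - a - h *\<^sub>R A v) / norm h) \<longlongrightarrow> 0) (at 0)"
      using \<gamma>(3) by (simp add: has_derivative_at a_def linear_scale[OF linA])
    then have "((\<lambda>h. norm ((\<phi> (\<gamma> h) - a) /\<^sub>R h - A v)) \<longlongrightarrow> 0) (at 0)"
    proof (rule Lim_transform_eventually)
      have "norm (x - h *\<^sub>R A v) / norm h = norm (x /\<^sub>R h - A v)" if "h \<noteq> 0" for h :: real and x
      proof -
        have "x /\<^sub>R h - A v = (x - h *\<^sub>R A v) /\<^sub>R h" using that by (simp add: scaleR_right_diff_distrib)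
        then show ?thesis by (simp add: divide_inverse_commute)
      qed
      then show "eventually (\<lambda>h. norm (\<phi> (\<gamma> h) - a - h *\<^sub>R A v) / norm h =
          norm ((\<phi> (\<gamma> h) - a) /\<^sub>R h - A v)) (at 0)"
        by (auto simp: eventually_at_filter)
    qed
    then have lim: "((\<lambda>t. (\<phi> (\<gamma> t) - a) /\<^sub>R t) \<longlongrightarrow> A v) (at 0)"
      by (rule tendsto_norm_zero_cancel[THEN LIM_zero_cancel])
    have "isCont \<gamma> 0" using \<gamma>(4) has_vector_derivative_continuous by blast
    then have "(\<gamma> \<longlongrightarrow> p) (at 0)" using \<gamma>(3) by (simp add: isCont_def)
    then have "eventually (\<lambda>t. \<gamma> t \<in> U) (at 0)" using U by (rule topological_tendstoD)
    moreover have "eventually (\<lambda>t. t \<in> {-e<..<e}) (at (0::real))"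
      using \<gamma>(1) by (intro eventually_at_in_open') auto
    ultimately have "eventually (\<lambda>t. (\<phi> (\<gamma> t) - a) /\<^sub>R t \<in> E) (at 0)"
    proof eventually_elim
      case (elim t)
      then have "\<phi> (\<gamma> t) \<in> E" using mem \<gamma>(2) by blast
      then show ?case using a(2) E(1) by (intro subspace_scale subspace_diff)
    qed
    then have "A v \<in> E"
      using lim closed_subspace[OF E(1)] by (intro Lim_in_closed_set) auto
    then show "v \<in> B ` E" using BA[of v] by (metis image_eqI)
  next
    fix v assume "v \<in> B ` E"
    then obtain w where w: "w \<in> E" "v = B w" by blast
    obtain r where r: "r > 0" "ball a r \<subseteq> V" using V a(1) open_contains_ball by blast
    define e where "e = r / (norm w + 1)"
    have e: "e > 0" using r by (simp add: e_def add_nonneg_pos)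
    have inV: "a + t *\<^sub>R w \<in> V" if "t \<in> {-e<..<e}" for t
    proof -
      have "\<bar>t\<bar> * norm w \<le> \<bar>t\<bar> * (norm w + 1)" by (intro mult_left_mono) auto
      also have "\<dots> < e * (norm w + 1)" using that by (intro mult_strict_right_mono) (auto simp: add_nonneg_pos)
      also have "\<dots> = r" unfolding e_def using norm_ge_zero[of w] by (simp add: add_nonneg_eq_0_iff)
      finally have "a + t *\<^sub>R w \<in> ball a r" by (simp add: dist_norm)
      then show ?thesis using r by blast
    qed
    show "v \<in> tangent_space M p"
      unfolding tangent_space_def mem_Collect_eq
    proof (intro exI conjI)
      show "0 < e" by (rule e)
      show "smooth_on (\<lambda>t. \<psi> (a + t *\<^sub>R w)) {-e<..<e}"
        using sm(2) inV unfolding smooth_on_def by (blast intro: Ck_on_affine open_greaterThanLessThan)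
      show "(\<lambda>t. \<psi> (a + t *\<^sub>R w)) ` {-e<..<e} \<subseteq> M"
      proof safe
        fix t assume t: "t \<in> {-e<..<e}"
        have "a + t *\<^sub>R w \<in> E" using a w E by (intro subspace_add subspace_scale)
        then show "\<psi> (a + t *\<^sub>R w) \<in> M" using mem[OF UV(3)[OF inV[OF t]]] UV(4)[OF inV[OF t]] by simp
      qed
      show "\<psi> (a + 0 *\<^sub>R w) = p" using a by simp
      have "((\<lambda>t. a + t *\<^sub>R w) has_derivative (\<lambda>s. s *\<^sub>R w)) (at 0)"
        by (auto intro!: derivative_eq_intros)
      then have "((\<lambda>t. \<psi> (a + t *\<^sub>R w)) has_derivative (\<lambda>s. B (s *\<^sub>R w))) (at 0)"
        using has_derivative_compose[of "\<lambda>t. a + t *\<^sub>R w" "\<lambda>s. s *\<^sub>R w" 0 UNIV \<psi> B] B by simp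
      then show "((\<lambda>t. \<psi> (a + t *\<^sub>R w)) has_vector_derivative v) (at 0)"
        by (simp add: has_vector_derivative_def linear_scale[OF linB] w)
    qed
  qed
  show "subspace (tangent_space M p)" unfolding T by (rule linear_subspace_image[OF linB E(1)])
  have "inj B" using AB by (metis injI)
  then show "dim (tangent_space M p) = d"
    unfolding T using dim_image_eq[OF linB] E(2) inj_on_subset by blast
  obtain K where K: "K > 0" "\<And>v. norm (A v) \<le> K * norm v"
    using linear_bounded_pos[OF linA] by blast
  obtain r1 where r1: "r1 > 0" "cball p r1 \<subseteq> U"
    "\<And>y z. y \<in> cball p r1 \<Longrightarrow> z \<in> cball p r1 \<Longrightarrow> norm (\<phi> y - \<phi> z - A (y - z)) \<le> 1 * norm (y - z)"
    unfolding A_def by (rule smooth_on_strictly_differentiable[OF sm(1) U, of 1]) auto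
  have lip: "norm (\<phi> y - \<phi> z) \<le> (K + 1) * norm (y - z)" if "y \<in> cball p r1" "z \<in> cball p r1" for y z
    using norm_triangle_ineq[of "\<phi> y - \<phi> z - A (y - z)" "A (y - z)"] r1(3)[OF that] K(2)[of "y - z"]
    by (simp add: distrib_right)
  show "\<exists>r>0. closed (M \<inter> cball p r)"
  proof (intro exI conjI)
    have "continuous_on (cball p r1) \<phi>"
      using hom r1(2) by (meson continuous_on_subset homeomorphism_def)
    then have "closed (cball p r1 \<inter> \<phi> -` E)"
      by (intro continuous_closed_preimage closed_subspace[OF E(1)] closed_cball)
    moreover have "cball p r1 \<inter> \<phi> -` E = M \<inter> cball p r1" using mem r1(2) by auto
    ultimately show "closed (M \<inter> cball p r1)" by simp
  qed (rule r1)
  have both: "(\<exists>r>0. \<forall>y\<in>M \<inter> cball p r. \<forall>z\<in>M \<inter> cball p r.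
         \<exists>u\<in>tangent_space M p. norm (y - z - u) \<le> \<eta> * norm (y - z)) \<and>
      (\<exists>r>0. \<forall>c\<in>M \<inter> cball p r. \<forall>u\<in>tangent_space M p.
         \<exists>\<delta>>0. \<forall>t. 0 < t \<and> t < \<delta> \<longrightarrow> (\<exists>z\<in>M. norm (z - c - t *\<^sub>R u) \<le> \<eta> * t * norm u))"
    if \<eta>: "\<eta> > 0" for \<eta>
  proof (intro conjI)
    \<comment> \<open>The tolerance is divided by \<open>K + 1\<close>, which bounds both the
      Lipschitz constant of \<open>\<phi>\<close> near \<open>p\<close> and, in the second claim,
      the ratio of \<open>norm w\<close> to \<open>norm u\<close>.\<close>
    obtain r2 where r2: "r2 > 0" "cball a r2 \<subseteq> V"
      "\<And>y z. y \<in> cball a r2 \<Longrightarrow> z \<in> cball a r2 \<Longrightarrow> norm (\<psi> y - \<psi> z - B (y - z)) \<le> \<eta> / (K + 1) * norm (y - z)"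
      unfolding B_def
      using smooth_on_strictly_differentiable[OF sm(2) V a(1), of "\<eta> / (K + 1)"] \<eta> K(1) by auto
    \<comment> \<open>Half of \<open>r2\<close> is for \<open>\<phi> c\<close>; the other half is
      left for the displacement \<open>t *\<^sub>R w\<close>.\<close>
    define r where "r = min r1 (r2 / (2 * (K + 1)))"
    have r: "r > 0" "r \<le> r1" "(K + 1) * r \<le> r2 / 2"
    proof -
      show "r > 0" "r \<le> r1" using r1 r2 K by (simp_all add: r_def)
      have "(K + 1) * r \<le> (K + 1) * (r2 / (2 * (K + 1)))"
        using K by (intro mult_left_mono) (auto simp: r_def)
      also have "\<dots> = r2 / 2" using K(1) by (simp add: field_simps)
      finally show "(K + 1) * r \<le> r2 / 2" .
    qed
    have in1: "y \<in> cball p r1" if "y \<in> cball p r" for y using that r(2) by auto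
    have inU: "y \<in> U" if "y \<in> cball p r" for y using in1[OF that] r1(2) by blast
    have \<phi>r: "norm (\<phi> y - a) \<le> r2 / 2" if "y \<in> cball p r" for y
    proof -
      have "norm (\<phi> y - a) \<le> (K + 1) * norm (y - p)"
        unfolding a_def using lip[OF in1[OF that], of p] r1(1) by simp
      also have "\<dots> \<le> (K + 1) * r"
        using that K(1) by (intro mult_left_mono) (auto simp: dist_norm norm_minus_commute)
      finally show ?thesis using r(3) by linarith
    qed
    have \<phi>r': "\<phi> y \<in> cball a r2" if "y \<in> cball p r" for y
      using \<phi>r[OF that] r2(1) by (simp add: dist_norm norm_minus_commute)
    show "\<exists>r>0. \<forall>y\<in>M \<inter> cball p r. \<forall>z\<in>M \<inter> cball p r.
           \<exists>u\<in>tangent_space M p. norm (y - z - u) \<le> \<eta> * norm (y - z)"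
    proof (rule exI[of _ r], intro conjI ballI r(1))
      fix y z assume y: "y \<in> M \<inter> cball p r" and z: "z \<in> M \<inter> cball p r"
      have "norm (\<psi> (\<phi> y) - \<psi> (\<phi> z) - B (\<phi> y - \<phi> z)) \<le> \<eta> / (K + 1) * norm (\<phi> y - \<phi> z)"
        using y z by (intro r2(3) \<phi>r') auto
      also have "\<dots> \<le> \<eta> / (K + 1) * ((K + 1) * norm (y - z))"
        using y z \<eta> K(1) by (intro mult_left_mono lip in1) auto
      also have "\<dots> = \<eta> * norm (y - z)" using K(1) by (simp add: field_simps)
      finally have "norm (y - z - B (\<phi> y - \<phi> z)) \<le> \<eta> * norm (y - z)"
        using y z UV(2) inU by simp
      moreover have "B (\<phi> y - \<phi> z) \<in> tangent_space M p"
        unfolding T using y z mem inU by (intro imageI subspace_diff E) auto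
      ultimately show "\<exists>u\<in>tangent_space M p. norm (y - z - u) \<le> \<eta> * norm (y - z)" by blast
    qed
    show "\<exists>r>0. \<forall>c\<in>M \<inter> cball p r. \<forall>u\<in>tangent_space M p.
           \<exists>\<delta>>0. \<forall>t. 0 < t \<and> t < \<delta> \<longrightarrow> (\<exists>z\<in>M. norm (z - c - t *\<^sub>R u) \<le> \<eta> * t * norm u)"
    proof (rule exI[of _ r], intro conjI ballI r(1))
      fix c u assume c: "c \<in> M \<inter> cball p r" and u: "u \<in> tangent_space M p"
      obtain w where w: "w \<in> E" "u = B w" using u T by blast
      have nw: "norm w \<le> (K + 1) * norm u"
        using K(2)[of u] w AB by (simp add: distrib_right add_increasing2)
      define \<delta> where "\<delta> = r2 / 2 / (norm w + 1)"
      show "\<exists>\<delta>>0. \<forall>t. 0 < t \<and> t < \<delta> \<longrightarrow> (\<exists>z\<in>M. norm (z - c - t *\<^sub>R u) \<le> \<eta> * t * norm u)"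
      proof (intro exI[of _ \<delta>] conjI allI impI)
        show "\<delta> > 0" using r2(1) by (simp add: \<delta>_def add_nonneg_pos)
        fix t assume t: "0 < t \<and> t < \<delta>"
        have "t * norm w \<le> t * (norm w + 1)" using t by (intro mult_left_mono) auto
        also have "\<dots> \<le> \<delta> * (norm w + 1)" using t by (intro mult_right_mono) auto
        also have "\<dots> = r2 / 2"
        proof -
          have "norm w + 1 \<noteq> 0" using norm_ge_zero[of w] by linarith
          from nonzero_eq_divide_eq[OF this, THEN iffD1, OF \<delta>_def] show ?thesis .
        qed
        finally have tw: "t * norm w \<le> r2 / 2" .
        let ?y = "\<phi> c + t *\<^sub>R w"
        have "norm ((\<phi> c - a) + t *\<^sub>R w) \<le> r2"
          using norm_triangle_ineq[of "\<phi> c - a" "t *\<^sub>R w"] \<phi>r[of c] tw c t by simp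
        then have y: "?y \<in> cball a r2"
          by (simp add: dist_norm norm_minus_commute[of a] diff_add_eq)
        have yV: "?y \<in> V" using y r2(2) by blast
        have "\<phi> c \<in> E" using c mem[of c] inU[of c] by auto
        then have yE: "?y \<in> E" using w by (intro subspace_add[OF E(1)] subspace_scale[OF E(1)])
        have "norm (\<psi> ?y - \<psi> (\<phi> c) - B (?y - \<phi> c)) \<le> \<eta> / (K + 1) * norm (?y - \<phi> c)"
          using c by (intro r2(3) y \<phi>r') auto
        then have "norm (\<psi> ?y - c - t *\<^sub>R u) \<le> \<eta> / (K + 1) * (t * norm w)"
          using c UV(2) inU t by (simp add: linear_scale[OF linB] w(2))
        also have "\<dots> \<le> \<eta> / (K + 1) * (t * ((K + 1) * norm u))"
          using nw t \<eta> K(1) by (intro mult_left_mono) auto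
        also have "\<dots> = \<eta> * t * norm u" using K(1) by (simp add: field_simps)
        finally show "\<exists>z\<in>M. norm (z - c - t *\<^sub>R u) \<le> \<eta> * t * norm u"
          using mem[OF UV(3)[OF yV]] UV(4)[OF yV] yE by auto
      qed
    qed
  qed
  show "\<exists>r>0. \<forall>y\<in>M \<inter> cball p r. \<forall>z\<in>M \<inter> cball p r.
         \<exists>u\<in>tangent_space M p. norm (y - z - u) \<le> \<eta> * norm (y - z)" if "\<eta> > 0" for \<eta>
    using both[OF that] by (rule conjunct1)
  show "\<exists>r>0. \<forall>c\<in>M \<inter> cball p r. \<forall>u\<in>tangent_space M p.
         \<exists>\<delta>>0. \<forall>t. 0 < t \<and> t < \<delta> \<longrightarrow> (\<exists>z\<in>M. norm (z - c - t *\<^sub>R u) \<le> \<eta> * t * norm u)" if "\<eta> > 0" for \<eta>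
    using both[OF that] by (rule conjunct2)
qed

subsection \<open>Local polynomial convexity\<close>

lemma norm_hermitian_product_le: "norm (hermitian_product z w) \<le> norm z * norm w"
proof -
  have "norm (hermitian_product z w) \<le> (\<Sum>k\<in>UNIV. \<bar>norm (z $ k)\<bar> * \<bar>norm (w $ k)\<bar>)"
    unfolding hermitian_product_def by (rule sum_norm_le) (simp add: norm_mult)
  also have "\<dots> \<le> norm z * norm w" unfolding norm_vec_def by (rule L2_set_mult_ineq)
  finally show ?thesis .
qed

text \<open>A point outside the ball lies beyond a supporting real hyperplane, and the complex
  affine function dual to \<open>z0 - p\<close> detects this.\<close>

lemma separate_outside_cball:
  fixes p z0 :: "complex ^ 'n"
  assumes \<epsilon>: "\<epsilon> \<ge> 0" and z0: "z0 \<notin> cball p \<epsilon>"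
  shows "\<exists>f a. poly_approx Y f \<and> (\<forall>z\<in>cball p \<epsilon>. norm (f z) \<le> a) \<and> a < norm (f z0)"
proof (intro exI conjI ballI)
  let ?f = "\<lambda>z. hermitian_product (z - p) (z0 - p)"
  show "poly_approx Y ?f"
    unfolding hermitian_product_def vector_minus_component
    by (intro poly_approx_polynomial holomorphic_polynomial_intros)
  have far: "\<epsilon> < norm (z0 - p)" using z0 by (simp add: dist_norm norm_minus_commute)
  show "norm (?f z) \<le> \<epsilon> * norm (z0 - p)" if "z \<in> cball p \<epsilon>" for z
  proof -
    have "norm (?f z) \<le> norm (z - p) * norm (z0 - p)" by (rule norm_hermitian_product_le)
    also have "\<dots> \<le> \<epsilon> * norm (z0 - p)"
      using that by (intro mult_right_mono) (auto simp: dist_norm norm_minus_commute)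
    finally show ?thesis .
  qed
  show "\<epsilon> * norm (z0 - p) < norm (?f z0)"
  proof (cases "z0 = p")
    case True
    then show ?thesis using far \<epsilon> by simp
  next
    case False
    then have "\<epsilon> * norm (z0 - p) < norm (z0 - p) * norm (z0 - p)"
      using far by (intro mult_strict_right_mono) auto
    also have "\<dots> = Re (?f z0)"
      by (simp add: Re_hermitian_product dot_square_norm power2_eq_square)
    also have "\<dots> \<le> norm (?f z0)" by (rule complex_Re_le_cmod)
    finally show ?thesis .
  qed
qed

text \<open>First variation at a nearest point, using only secants instead of tangents at that point.\<close>
lemma nearest_point_inner_le:
  fixes w u :: "'a::real_inner"
  assumes \<delta>: "\<delta> > 0"
    and near: "\<And>t. 0 < t \<Longrightarrow> t < \<delta> \<Longrightarrow>
      \<exists>v. norm (v - t *\<^sub>R u) \<le> (1/2) * t * norm u \<and> norm w \<le> norm (w - v)"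
  shows "w \<bullet> u \<le> 1/2 * norm w * norm u"
proof (rule ccontr)
  assume "\<not> ?thesis"
  then have k: "2 * (w \<bullet> u) - norm w * norm u > 0" by simp
  define k where "k = 2 * (w \<bullet> u) - norm w * norm u"
  \<comment> \<open>The violation \<open>k\<close> enters linearly, as
    \<open>t * k \<le> (norm v)\<^sup>2\<close>. Since \<open>norm v \<le> 3/2 * t * norm u\<close>,
    the denominator \<open>9\<close> bounds the right-hand side by \<open>t * k / 4\<close>; the
    summand \<open>1\<close> admits \<open>u = 0\<close>.\<close>
  define t where "t = min (\<delta>/2) (k / (9 * ((norm u)\<^sup>2 + 1)))"
  have pos: "9 * ((norm u)\<^sup>2 + 1) > 0" by (simp add: add_nonneg_pos)
  have t: "0 < t" "t < \<delta>" using \<delta> k pos by (auto simp: t_def k_def)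
  obtain v where v: "norm (v - t *\<^sub>R u) \<le> (1/2) * t * norm u" "norm w \<le> norm (w - v)"
    using near[OF t] by blast
  have "norm v \<le> norm (v - t *\<^sub>R u) + norm (t *\<^sub>R u)"
    using norm_triangle_ineq[of "v - t *\<^sub>R u" "t *\<^sub>R u"] by simp
  then have nv: "norm v \<le> 3/2 * (t * norm u)" using v(1) t by simp
  have "w \<bullet> (v - t *\<^sub>R u) \<ge> - (norm w * norm (v - t *\<^sub>R u))"
    using Cauchy_Schwarz_ineq2[of w "v - t *\<^sub>R u"] by linarith
  moreover have "norm w * norm (v - t *\<^sub>R u) \<le> norm w * ((1/2) * t * norm u)"
    using v(1) by (intro mult_left_mono) auto
  ultimately have "w \<bullet> v \<ge> t * (w \<bullet> u) - norm w * ((1/2) * t * norm u)"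
    by (simp add: inner_diff_right)
  moreover have "2 * (w \<bullet> v) \<le> (norm v)\<^sup>2"
    using power_mono[OF v(2), of 2] by (simp add: power2_norm_eq_inner algebra_simps inner_commute)
  moreover have "(norm v)\<^sup>2 \<le> (3/2 * (t * norm u))\<^sup>2" using nv by (intro power_mono) auto
  ultimately have "t * k \<le> t * (9/4 * t * (norm u)\<^sup>2)"
    by (simp add: k_def power2_eq_square algebra_simps)
  then have "k \<le> 9/4 * t * (norm u)\<^sup>2" using t by simp
  also have "\<dots> \<le> 9/4 * (t * ((norm u)\<^sup>2 + 1))" using t by (simp add: distrib_left)
  also have "\<dots> \<le> 9/4 * (k / (9 * ((norm u)\<^sup>2 + 1)) * ((norm u)\<^sup>2 + 1))"
    by (intro mult_left_mono mult_right_mono) (auto simp: t_def)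
  also have "\<dots> = k / 4" using pos by (simp add: field_simps)
  finally have "k \<le> k / 4" .
  moreover have "k > 0" unfolding k_def by (rule k)
  ultimately show False by linarith
qed

text \<open>A nearest point of \<open>L \<inter> cball p \<epsilon>\<close> itself could lie on the
  boundary sphere, where minimality says nothing about directions leaving the ball. Hence
  \<open>c\<close> minimises over \<open>cball p R\<close>; it may leave
  \<open>cball p \<epsilon>\<close>, which is harmless because the secant estimate holds throughout
  \<open>cball p R\<close>.\<close>

lemma lagrangian_locally_polynomially_convex:
  fixes L :: "(complex ^ 'n) set"
  assumes L: "lagrangian_submanifold L" and p: "p \<in> L"
  shows "\<exists>r>0. \<forall>\<epsilon>. 0 < \<epsilon> \<and> \<epsilon> < r \<longrightarrow> polynomially_convex (L \<inter> cball p \<epsilon>)"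
proof -
  have sub: "smooth_submanifold CARD('n) L"
    and iso: "\<And>u v. u \<in> tangent_space L p \<Longrightarrow> v \<in> tangent_space L p \<Longrightarrow> symplectic_form u v = 0"
    using L p by (auto simp: lagrangian_submanifold_def)
  let ?T = "tangent_space L p"
  obtain Q where Q: "\<And>c. holomorphic_polynomial (\<lambda>z. Q (z - c))"
    "\<And>z u. u \<in> ?T \<Longrightarrow> Re (Q z) \<ge> (norm z)\<^sup>2 - 2 * (norm (z - u))\<^sup>2"
    "\<And>z. \<exists>u\<in>?T. Re (Q z) = (norm z)\<^sup>2 - 2 * (norm (z - u))\<^sup>2"
    using lagrangian_plane_form[OF subspace_tangent_space[OF sub p] dim_tangent_space[OF sub p] iso]
    by metis
  obtain r0 where r0: "r0 > 0" "closed (L \<inter> cball p r0)"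
    using smooth_submanifold_locally_closed[OF sub p] by blast
  obtain r1 where r1: "r1 > 0" "\<And>y z. y \<in> L \<inter> cball p r1 \<Longrightarrow> z \<in> L \<inter> cball p r1 \<Longrightarrow>
      \<exists>u\<in>?T. norm (y - z - u) \<le> 1/2 * norm (y - z)"
    using smooth_submanifold_nearly_flat[OF sub p, of "1/2"] by auto
  obtain r2 where r2: "r2 > 0" "\<And>c u. c \<in> L \<inter> cball p r2 \<Longrightarrow> u \<in> ?T \<Longrightarrow>
      \<exists>\<delta>>0. \<forall>t. 0 < t \<and> t < \<delta> \<longrightarrow> (\<exists>z\<in>L. norm (z - c - t *\<^sub>R u) \<le> 1/2 * t * norm u)"
    using smooth_submanifold_move[OF sub p, of "1/2"] by auto
  define R where "R = min r0 (min r1 r2)"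
  have R: "R > 0" "R \<le> r0" "R \<le> r1" "R \<le> r2" using r0 r1 r2 by (auto simp: R_def)
  have closed: "closed (L \<inter> cball p \<epsilon>)" if "\<epsilon> \<le> R" for \<epsilon>
  proof -
    have "L \<inter> cball p \<epsilon> = (L \<inter> cball p r0) \<inter> cball p \<epsilon>" using that R by auto
    then show ?thesis using r0(2) by auto
  qed
  then have compact: "compact (L \<inter> cball p \<epsilon>)" if "\<epsilon> \<le> R" for \<epsilon>
    using that by (simp add: compact_eq_bounded_closed bounded_Int)
  show ?thesis
  \<comment> \<open>With \<open>\<epsilon> < R/4\<close> one gets
    \<open>norm (c - p) \<le> 2 * \<epsilon> < R/2\<close>, which leaves \<open>R/2\<close> for
    moving along \<open>L\<close> inside \<open>cball p R\<close>.\<close>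
  proof (intro exI[of _ "R/4"] conjI allI impI)
    show "R/4 > 0" using R by simp
    fix \<epsilon> assume \<epsilon>: "0 < \<epsilon> \<and> \<epsilon> < R/4"
    show "polynomially_convex (L \<inter> cball p \<epsilon>)"
    proof (rule polynomially_convexI)
      show "compact (L \<inter> cball p \<epsilon>)" using compact[of \<epsilon>] \<epsilon> R by simp
      fix z0 assume z0: "z0 \<notin> L \<inter> cball p \<epsilon>"
      show "\<exists>f a. poly_approx (insert z0 (L \<inter> cball p \<epsilon>)) f \<and>
          (\<forall>z\<in>L \<inter> cball p \<epsilon>. norm (f z) \<le> a) \<and> a < norm (f z0)"
      proof (cases "z0 \<in> cball p \<epsilon>")
        case False
        then show ?thesis using separate_outside_cball[OF _ False] \<epsilon> by (metis IntD2 less_imp_le)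
      next
        case True
        have "\<exists>c\<in>L \<inter> cball p R. \<forall>y\<in>L \<inter> cball p R. norm (z0 - c) \<le> norm (z0 - y)"
          using p R by (intro continuous_attains_inf compact continuous_intros) auto
        then obtain c where c: "c \<in> L" "c \<in> cball p R"
          "\<And>y. y \<in> L \<Longrightarrow> y \<in> cball p R \<Longrightarrow> norm (z0 - c) \<le> norm (z0 - y)" by blast
        have z0p: "norm (z0 - p) \<le> \<epsilon>" using True by (simp add: dist_norm norm_minus_commute)
        have "norm (z0 - c) \<le> \<epsilon>" using c(3)[of p] p R z0p by simp
        then have cp: "norm (c - p) \<le> 2 * \<epsilon>"
          using norm_triangle_ineq[of "c - z0" "z0 - p"] z0p by (simp add: norm_minus_commute)
        define w where "w = z0 - c"
        have w: "w \<noteq> 0" using z0 c(1) True by (auto simp: w_def)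
        have inner: "w \<bullet> u \<le> 1/2 * norm w * norm u" if u: "u \<in> ?T" for u
        proof -
          obtain \<delta> where \<delta>: "\<delta> > 0"
            "\<And>t. 0 < t \<Longrightarrow> t < \<delta> \<Longrightarrow> \<exists>z\<in>L. norm (z - c - t *\<^sub>R u) \<le> 1/2 * t * norm u"
            using r2(2)[of c u] c R u by auto
          \<comment> \<open>Keeps the displaced point, at distance at most
            \<open>3/2 * t * norm u\<close> from \<open>c\<close>, in the ball where
            \<open>c\<close> is a minimiser.\<close>
          define \<delta>' where "\<delta>' = min \<delta> (R / (3 * (norm u + 1)))"
          have pos: "3 * (norm u + 1) > 0" by (simp add: add_nonneg_pos)
          show ?thesis
          proof (rule nearest_point_inner_le)
            show "\<delta>' > 0" using \<delta> R pos by (simp add: \<delta>'_def)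
            fix t assume t: "0 < t" "t < \<delta>'"
            then obtain z where z: "z \<in> L" "norm (z - c - t *\<^sub>R u) \<le> 1/2 * t * norm u"
              using \<delta>(2)[of t] by (auto simp: \<delta>'_def)
            have "t * (3 * (norm u + 1)) < R"
              using t pos by (simp add: \<delta>'_def pos_less_divide_eq)
            then have "3/2 * (t * norm u) \<le> R / 2" using t by (simp add: algebra_simps)
            moreover have "norm (z - p) \<le> norm (z - c - t *\<^sub>R u) + norm (t *\<^sub>R u) + norm (c - p)"
              using norm_triangle_ineq[of "z - c - t *\<^sub>R u" "t *\<^sub>R u"]
                norm_triangle_ineq[of "z - c" "c - p"] by simp
            ultimately have "norm (z - p) \<le> R" using z(2) cp \<epsilon> t by simp
            then have "norm (z0 - c) \<le> norm (z0 - z)"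
              by (intro c(3) z(1)) (simp add: dist_norm norm_minus_commute)
            then show "\<exists>v. norm (v - t *\<^sub>R u) \<le> (1/2) * t * norm u \<and> norm w \<le> norm (w - v)"
              using z(2) by (intro exI[of _ "z - c"]) (simp add: w_def)
          qed
        qed
        \<comment> \<open>With \<open>w \<bullet> u \<le> 1/2 * norm w * norm u\<close>, completing
          the square gives \<open>Re (Q w) \<le> - (norm w)\<^sup>2 / 2\<close>.\<close>
        have neg: "Re (Q w) < 0"
        proof -
          obtain u where u: "u \<in> ?T" "Re (Q w) = (norm w)\<^sup>2 - 2 * (norm (w - u))\<^sup>2"
            using Q(3) by blast
          have "(norm (w - u))\<^sup>2 = (norm w)\<^sup>2 - 2 * (w \<bullet> u) + (norm u)\<^sup>2"
            by (simp add: power2_norm_eq_inner algebra_simps inner_commute)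
          moreover have "(norm w)\<^sup>2 - norm w * norm u + (norm u)\<^sup>2 \<ge> 3/4 * (norm w)\<^sup>2"
            using zero_le_power2[of "norm w / 2 - norm u"] by (simp add: power2_eq_square algebra_simps)
          moreover have "(norm w)\<^sup>2 > 0" using w by simp
          ultimately show ?thesis using inner[OF u(1)] u(2) by linarith
        qed
        show ?thesis
        proof (intro exI conjI ballI)
          have "poly_approx Y (\<lambda>z. exp (0 - Q (z - c)))" if "compact Y" for Y
            by (intro poly_approx_exp that poly_approx_polynomial holomorphic_polynomial_diff
                holomorphic_polynomial_const Q)
          then show "poly_approx (insert z0 (L \<inter> cball p \<epsilon>)) (\<lambda>z. exp (- Q (z - c)))"
            using compact[of \<epsilon>] \<epsilon> R by simp
          show "1 < norm (exp (- Q (z0 - c)))" using neg by (simp add: w_def)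
          fix z assume z: "z \<in> L \<inter> cball p \<epsilon>"
          then obtain u where u: "u \<in> ?T" "norm (z - c - u) \<le> 1/2 * norm (z - c)"
            using r1(2)[of z c] c R \<epsilon> by auto
          have "(norm (z - c - u))\<^sup>2 \<le> (1/2 * norm (z - c))\<^sup>2" using u(2) by (intro power_mono) auto
          then have "4 * (norm (z - c - u))\<^sup>2 \<le> (norm (z - c))\<^sup>2"
            by (simp add: power_mult_distrib power_divide)
          then have "Re (Q (z - c)) \<ge> 0"
            using Q(2)[OF u(1), of "z - c"] zero_le_power2[of "norm (z - c - u)"] by linarith
          then show "norm (exp (- Q (z - c))) \<le> 1" by simp
        qed
      qed
    qed
  qed
qed

text \<open>
  Why \<open>Q\<^sub>2 - Q\<^sub>1\<close> separates the two sheets: each \<open>Re Q\<^sub>i\<close> is at most \<open>norm\<^sup>2\<close>, with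
  equality exactly on the tangent plane \<open>T\<^sub>i\<close>, and the tangent planes meet only in \<open>0\<close>.
\<close>
theorem theorem1p3:
  fixes L1 L2 :: "(complex ^ 'n) set" and p :: "complex ^ 'n"
  assumes "lagrangian_submanifold L1"
    and "lagrangian_submanifold L2"
    and "intersect_transversally_at L1 L2 p"
  shows "locally_polynomially_convex_near (L1 \<union> L2) p"
proof -
  have p: "p \<in> L1" "p \<in> L2" using assms(3) by (auto simp: intersect_transversally_at_def)
  let ?T1 = "tangent_space L1 p" and ?T2 = "tangent_space L2 p"
  have sub: "smooth_submanifold CARD('n) L1" "smooth_submanifold CARD('n) L2"
    and iso: "\<And>u v. u \<in> ?T1 \<Longrightarrow> v \<in> ?T1 \<Longrightarrow> symplectic_form u v = 0"
      "\<And>u v. u \<in> ?T2 \<Longrightarrow> v \<in> ?T2 \<Longrightarrow> symplectic_form u v = 0"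
    using assms(1,2) p by (auto simp: lagrangian_submanifold_def)
  note T1 = subspace_tangent_space[OF sub(1) p(1)] dim_tangent_space[OF sub(1) p(1)]
  note T2 = subspace_tangent_space[OF sub(2) p(2)] dim_tangent_space[OF sub(2) p(2)]
  have "{u + v | u v. u \<in> ?T1 \<and> v \<in> ?T2} = UNIV"
    using assms(3) by (simp add: intersect_transversally_at_def)
  \<comment> \<open>Two planes of half the dimension that together span the space have no common
    direction.\<close>
  then have "dim (UNIV :: (complex ^ 'n) set) + dim (?T1 \<inter> ?T2) = 2 * CARD('n)"
    using dim_sums_Int[OF T1(1) T2(1)] T1(2) T2(2) by simp
  then have "dim (?T1 \<inter> ?T2) = 0" by simp
  then have T12: "?T1 \<inter> ?T2 \<subseteq> {0}" by simp
  obtain Q1 where Q1: "\<And>c. holomorphic_polynomial (\<lambda>z. Q1 (z - c))"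
    "\<And>a z. Q1 (a *\<^sub>R z) = of_real (a\<^sup>2) * Q1 z" "\<And>z. norm (Q1 z) \<le> (norm z)\<^sup>2"
    "\<And>z u. u \<in> ?T1 \<Longrightarrow> Re (Q1 z) \<ge> (norm z)\<^sup>2 - 2 * (norm (z - u))\<^sup>2"
    "\<And>z. \<exists>u\<in>?T1. Re (Q1 z) = (norm z)\<^sup>2 - 2 * (norm (z - u))\<^sup>2"
    by (rule lagrangian_plane_form[OF T1 iso(1)]) (assumption | rule that)+
  obtain Q2 where Q2: "\<And>c. holomorphic_polynomial (\<lambda>z. Q2 (z - c))"
    "\<And>a z. Q2 (a *\<^sub>R z) = of_real (a\<^sup>2) * Q2 z" "\<And>z. norm (Q2 z) \<le> (norm z)\<^sup>2"
    "\<And>z u. u \<in> ?T2 \<Longrightarrow> Re (Q2 z) \<ge> (norm z)\<^sup>2 - 2 * (norm (z - u))\<^sup>2"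
    "\<And>z. \<exists>u\<in>?T2. Re (Q2 z) = (norm z)\<^sup>2 - 2 * (norm (z - u))\<^sup>2"
    by (rule lagrangian_plane_form[OF T2 iso(2)]) (assumption | rule that)+
  \<comment> \<open>On the unit sphere \<open>Re Q1 + Re Q2\<close> is below \<open>2\<close>, since
    the value \<open>2\<close> would need a common unit vector of both planes. Compactness makes the
    defect uniform, homogeneity carries it to all \<open>w\<close>.\<close>
  obtain \<kappa> where \<kappa>: "\<kappa> > 0" "\<And>w. Re (Q1 w) + Re (Q2 w) \<le> (2 - \<kappa>) * (norm w)\<^sup>2"
  proof -
    have "continuous_on (sphere 0 1) (\<lambda>z. Re (Q1 z) + Re (Q2 z))"
      using holomorphic_polynomial_continuous_on[OF Q1(1)[of 0]]
        holomorphic_polynomial_continuous_on[OF Q2(1)[of 0]]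
      by (intro continuous_intros) auto
    then have "\<exists>x\<in>sphere 0 1. \<forall>y\<in>sphere 0 1. Re (Q1 y) + Re (Q2 y) \<le> Re (Q1 x) + Re (Q2 x)"
      by (intro continuous_attains_sup) auto
    then obtain x where x: "norm x = 1"
      "\<And>y. norm y = 1 \<Longrightarrow> Re (Q1 y) + Re (Q2 y) \<le> Re (Q1 x) + Re (Q2 x)" by auto
    obtain u1 where u1: "u1 \<in> ?T1" "Re (Q1 x) = 1 - 2 * (norm (x - u1))\<^sup>2" using Q1(5)[of x] x by auto
    obtain u2 where u2: "u2 \<in> ?T2" "Re (Q2 x) = 1 - 2 * (norm (x - u2))\<^sup>2" using Q2(5)[of x] x by auto
    have "x \<noteq> u1 \<or> x \<noteq> u2" using T12 u1(1) u2(1) x(1) by auto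
    then have "(norm (x - u1))\<^sup>2 > 0 \<or> (norm (x - u2))\<^sup>2 > 0" by simp
    then have lt: "2 - (Re (Q1 x) + Re (Q2 x)) > 0"
      unfolding u1(2) u2(2) using zero_le_power2[of "norm (x - u1)"] zero_le_power2[of "norm (x - u2)"]
      by linarith
    show thesis
    proof (rule that[OF lt])
      fix w :: "complex ^ 'n"
      show "Re (Q1 w) + Re (Q2 w) \<le> (2 - (2 - (Re (Q1 x) + Re (Q2 x)))) * (norm w)\<^sup>2"
      proof (cases "w = 0")
        case True
        then show ?thesis using Q1(3)[of 0] Q2(3)[of 0] by simp
      next
        case False
        define y where "y = w /\<^sub>R norm w"
        have y: "norm y = 1" "w = norm w *\<^sub>R y" using False by (auto simp: y_def)
        have "Re (Q1 w) + Re (Q2 w) = (norm w)\<^sup>2 * (Re (Q1 y) + Re (Q2 y))"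
          by (subst (1 2) y(2)) (simp add: Q1(2) Q2(2) distrib_left del: of_real_power)
        also have "\<dots> \<le> (norm w)\<^sup>2 * (Re (Q1 x) + Re (Q2 x))"
          using x(2)[OF y(1)] by (intro mult_left_mono) auto
        finally show ?thesis by (simp add: mult.commute)
      qed
    qed
  qed
  \<comment> \<open>Chosen for \<open>\<eta>\<^sup>2 \<le> \<kappa> / 8\<close>: curvature then
    costs at most half of \<open>\<kappa>\<close> in twice the real part of a sheet's own form, and
    the other half is the margin in \<open>neg\<close> and \<open>pos\<close>.\<close>
  define \<eta> where "\<eta> = min 1 \<kappa> / 4"
  have \<eta>: "\<eta> > 0" using \<kappa>(1) by (simp add: \<eta>_def)
  have "\<eta> * \<eta> \<le> (\<kappa> / 4) * (1 / 4)" using \<kappa>(1) by (intro mult_mono) (auto simp: \<eta>_def)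
  then have \<eta>2: "4 * \<eta>\<^sup>2 \<le> \<kappa> / 2" using \<kappa>(1) by (simp add: power2_eq_square)
  obtain r1 where r1: "r1 > 0" "\<And>y z. y \<in> L1 \<inter> cball p r1 \<Longrightarrow> z \<in> L1 \<inter> cball p r1 \<Longrightarrow>
      \<exists>u\<in>?T1. norm (y - z - u) \<le> \<eta> * norm (y - z)"
    using smooth_submanifold_nearly_flat[OF sub(1) p(1) \<eta>] by blast
  obtain r2 where r2: "r2 > 0" "\<And>y z. y \<in> L2 \<inter> cball p r2 \<Longrightarrow> z \<in> L2 \<inter> cball p r2 \<Longrightarrow>
      \<exists>u\<in>?T2. norm (y - z - u) \<le> \<eta> * norm (y - z)"
    using smooth_submanifold_nearly_flat[OF sub(2) p(2) \<eta>] by blast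
  obtain s1 where s1: "s1 > 0" "\<And>\<epsilon>. 0 < \<epsilon> \<Longrightarrow> \<epsilon> < s1 \<Longrightarrow> polynomially_convex (L1 \<inter> cball p \<epsilon>)"
    using lagrangian_locally_polynomially_convex[OF assms(1) p(1)] by blast
  obtain s2 where s2: "s2 > 0" "\<And>\<epsilon>. 0 < \<epsilon> \<Longrightarrow> \<epsilon> < s2 \<Longrightarrow> polynomially_convex (L2 \<inter> cball p \<epsilon>)"
    using lagrangian_locally_polynomially_convex[OF assms(2) p(2)] by blast
  define R where "R = min (min r1 r2) (min s1 s2)"
  define \<zeta> where "\<zeta> = (\<lambda>z. Q2 (z - p) - Q1 (z - p))"
  have \<zeta>: "holomorphic_polynomial \<zeta>" unfolding \<zeta>_def by (intro holomorphic_polynomial_diff Q1 Q2)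
  have Im\<zeta>: "\<bar>Im (\<zeta> z)\<bar> \<le> 2 * (norm (z - p))\<^sup>2" for z
    using abs_Im_le_cmod[of "\<zeta> z"] norm_triangle_ineq4[of "Q2 (z - p)" "Q1 (z - p)"]
      Q1(3)[of "z - p"] Q2(3)[of "z - p"] by (simp add: \<zeta>_def)
  have flat: "(norm (z - p))\<^sup>2 - 2 * (norm (z - p - u))\<^sup>2 \<ge> (1 - \<kappa> / 4) * (norm (z - p))\<^sup>2"
    if "norm (z - p - u) \<le> \<eta> * norm (z - p)" for z u
  proof -
    have "(norm (z - p - u))\<^sup>2 \<le> \<eta>\<^sup>2 * (norm (z - p))\<^sup>2"
      using power_mono[OF that, of 2] by (simp add: power_mult_distrib)
    also have "\<dots> \<le> (\<kappa> / 8) * (norm (z - p))\<^sup>2" using \<eta>2 by (intro mult_right_mono) auto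
    finally show ?thesis by (simp add: algebra_simps)
  qed
  have neg: "Re (\<zeta> z) \<le> - (\<kappa> / 2) * (norm (z - p))\<^sup>2" if z: "z \<in> L1" "z \<in> cball p r1" for z
  proof -
    obtain u where u: "u \<in> ?T1" "norm (z - p - u) \<le> \<eta> * norm (z - p)"
      using r1(2)[of z p] z p(1) r1(1) by auto
    \<comment> \<open>\<open>Q2 - Q1 = (Q1 + Q2) - 2 * Q1\<close>, where the real part of the sum
      has the bound with \<open>2 - \<kappa>\<close> and that of \<open>Q1\<close> is almost maximal
      on \<open>L1\<close>.\<close>
    have "Re (\<zeta> z) \<le> (2 - \<kappa>) * (norm (z - p))\<^sup>2 - 2 * Re (Q1 (z - p))"
      using \<kappa>(2)[of "z - p"] by (simp add: \<zeta>_def)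
    then show ?thesis using flat[OF u(2)] Q1(4)[OF u(1), of "z - p"] by (simp add: algebra_simps)
  qed
  have pos: "Re (\<zeta> z) \<ge> (\<kappa> / 2) * (norm (z - p))\<^sup>2" if z: "z \<in> L2" "z \<in> cball p r2" for z
  proof -
    obtain u where u: "u \<in> ?T2" "norm (z - p - u) \<le> \<eta> * norm (z - p)"
      using r2(2)[of z p] z p(2) r2(1) by auto
    have "Re (\<zeta> z) \<ge> 2 * Re (Q2 (z - p)) - (2 - \<kappa>) * (norm (z - p))\<^sup>2"
      using \<kappa>(2)[of "z - p"] by (simp add: \<zeta>_def)
    then show ?thesis using flat[OF u(2)] Q2(4)[OF u(1), of "z - p"] by (simp add: algebra_simps)
  qed
  \<comment> \<open>\<open>4 / \<kappa>\<close> is the quotient of the factors \<open>2\<close> for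
    \<open>Im\<close> and \<open>\<kappa> / 2\<close> for \<open>Re\<close> in front of
    \<open>(norm (z - p))\<^sup>2\<close>.\<close>
  have cone: "\<bar>Im (\<zeta> z)\<bar> \<le> 4 / \<kappa> * x" if "x \<ge> (\<kappa> / 2) * (norm (z - p))\<^sup>2" for z x
  proof -
    have "2 * (norm (z - p))\<^sup>2 = 4 / \<kappa> * ((\<kappa> / 2) * (norm (z - p))\<^sup>2)" using \<kappa>(1) by simp
    also have "\<dots> \<le> 4 / \<kappa> * x" using that \<kappa>(1) by (intro mult_left_mono) auto
    finally show ?thesis using Im\<zeta>[of z] by linarith
  qed
  have "polynomially_convex ((L1 \<union> L2) \<inter> cball p \<epsilon>)" if \<epsilon>: "0 < \<epsilon>" "\<epsilon> < R" for \<epsilon>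
  proof -
    have b: "z \<in> cball p r1" "z \<in> cball p r2" if "z \<in> cball p \<epsilon>" for z
      using that \<epsilon> by (auto simp: R_def)
    have "polynomially_convex ((L1 \<inter> cball p \<epsilon>) \<union> (L2 \<inter> cball p \<epsilon>))"
    proof (rule kallin[where p = p and \<zeta> = \<zeta> and C = "4 / \<kappa>"])
      show "polynomially_convex (L1 \<inter> cball p \<epsilon>)" "polynomially_convex (L2 \<inter> cball p \<epsilon>)"
        using s1(2) s2(2) \<epsilon> by (auto simp: R_def)
      show "p \<in> L1 \<inter> cball p \<epsilon>" "p \<in> L2 \<inter> cball p \<epsilon>" using p \<epsilon> by auto
      show "holomorphic_polynomial \<zeta>" by (rule \<zeta>)
      show "4 / \<kappa> > 0" using \<kappa>(1) by simp
      show "\<bar>Im (\<zeta> z)\<bar> \<le> 4 / \<kappa> * - Re (\<zeta> z)" if "z \<in> L1 \<inter> cball p \<epsilon>" for z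
        using neg[of z] b[of z] that by (intro cone) auto
      show "\<bar>Im (\<zeta> z)\<bar> \<le> 4 / \<kappa> * Re (\<zeta> z)" if "z \<in> L2 \<inter> cball p \<epsilon>" for z
        using pos[of z] b[of z] that by (intro cone) auto
      show "z = p" if z: "z \<in> L1 \<inter> cball p \<epsilon> \<union> L2 \<inter> cball p \<epsilon>" and "\<zeta> z = 0" for z
      proof -
        have "(\<kappa> / 2) * (norm (z - p))\<^sup>2 \<le> 0" using z neg[of z] pos[of z] b[of z] \<open>\<zeta> z = 0\<close> by auto
        then have "(norm (z - p))\<^sup>2 \<le> 0" using \<kappa>(1) by (simp add: mult_le_0_iff)
        then show ?thesis by simp
      qed
    qed
    then show ?thesis by (simp add: Int_Un_distrib2)
  qed
  moreover have "R > 0" using r1 r2 s1 s2 by (simp add: R_def)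
  ultimately show ?thesis
    unfolding locally_polynomially_convex_near_def using p by blast
qed

end
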